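(* Let $N\ge 1$ be an integer. The number of partitions of $N$ into parts congruent to $2$ or $3$ modulo $5$ with no $3$'s and no $8$'s is equal to the number of partitions $\lambda\in\mathsf{Diff_2}^*$ of $N$ such that one of the following holds: (1) $\lambda$ has $m\ge 8$ parts, and $col^*(\lambda)$ has no $3$'s and no $8$'s; (2) $\lambda$ has $m$ parts, $5\le m\le 7$, and $col^*(\lambda)$ has at most one $4$ and no $3$'s; (3) $\lambda$ has four parts, and $col^*(\lambda)=3^j2^k1^\ell$ has no $4$'s, with $j\le 2$ and $\ell\equiv 2,3,4 \pmod 7$; (4) $\lambda$ has three parts, and $col^*(\lambda)=2^k1^\ell$ has no $3$'s, with $\ell\not\equiv 3,4\pmod 7$; (5) $\lambda$ has two parts, and $col^*(\lambda)$ has exactly one $1$; (6) $\lambda$ has exactly one part, which is even.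
   Context: Partitions are written with weakly decreasing positive parts; $3^{j}2^{k}1^{\ell}$ denotes the partition with $j$ parts equal to $3$, $k$ parts equal to $2$ and $\ell$ parts equal to $1$ ($j,k,\ell\ge 0$). $\mathsf{Diff_2}$ is the set of partitions $\lambda=(\lambda_1,\dots,\lambda_m)$ whose consecutive differences are at least two, i.e. $\lambda_i-\lambda_{i+1}\ge 2$ for $1\le i<m$. $\mathsf{Diff_2}^*$ is the subset of those partitions in $\mathsf{Diff_2}$ with no part equal to $1$. For $\lambda=(\lambda_1,\dots,\lambda_m)\in\mathsf{Diff_2}^*$, $col^*(\lambda)$ is the partition formed by the columns of (i.e. the conjugate of) $(\lambda_1-2m,\lambda_2-2(m-1),\dots,\lambda_m-2)$, where zero entries are ignored. Example: $col^*((13,10,6,4))=(5,4,2,2)^T=(4,4,2,2,1)$. *)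

theory Defs
  imports Main
begin

text \<open>A partition is represented by the list of its parts, in weakly decreasing order.\<close>

definition is_partition :: "nat list \<Rightarrow> bool" where
  "is_partition p \<longleftrightarrow> sorted_wrt (\<ge>) p \<and> 0 \<notin> set p"

definition partitions_of :: "nat \<Rightarrow> nat list set" where
  "partitions_of n = {p. is_partition p \<and> sum_list p = n}"

definition Diff2 :: "nat list set" where
  "Diff2 = {lam. is_partition lam \<and> (\<forall>i. Suc i < length lam \<longrightarrow> lam ! Suc i + 2 \<le> lam ! i)}"

definition Diff2_star :: "nat list set" where
  "Diff2_star = {lam \<in> Diff2. 1 \<notin> set lam}"

text \<open>The \<open>j\<close>-th column of the diagram counts the rows of length at least \<open>j\<close>. Zero rows
  do not contribute to any column, so they are ignored.\<close>

definition conjugate :: "nat list \<Rightarrow> nat list" where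
  "conjugate mu =
     map (\<lambda>j. length (filter (\<lambda>x. j \<le> x) mu)) [1..<Suc (Max (insert 0 (set mu)))]"

text \<open>With zero-based indices, \<open>\<lambda>\<^sub>i - 2 (m - i + 1)\<close> becomes \<open>lam ! i - 2 * (m - i)\<close>.
  For \<open>lam \<in> Diff2_star\<close> this subtraction does not truncate.\<close>

definition col_star :: "nat list \<Rightarrow> nat list" where
  "col_star lam = conjugate (map (\<lambda>i. lam ! i - 2 * (length lam - i)) [0..<length lam])"

definition part321 :: "nat \<Rightarrow> nat \<Rightarrow> nat \<Rightarrow> nat list" where
  "part321 j k l = replicate j 3 @ replicate k 2 @ replicate l 1"

lemma col_star_example: "col_star [13, 10, 6, 4] = [4, 4, 2, 2, 1]"
  by (simp add: col_star_def conjugate_def upt_conv_Cons)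

lemma finite_partitions_of: "finite (partitions_of n)"
proof (rule finite_subset)
  show "partitions_of n \<subseteq> {p. set p \<subseteq> {..n} \<and> length p \<le> n}"
  proof
    fix p assume "p \<in> partitions_of n"
    then have s: "sum_list p = n" and z: "0 \<notin> set p"
      by (auto simp: partitions_of_def is_partition_def)
    have "length p \<le> sum_list p"
      using z by (induction p) auto
    with s show "p \<in> {p. set p \<subseteq> {..n} \<and> length p \<le> n}"
      using member_le_sum_list[of _ p] by auto
  qed
  show "finite {p. set p \<subseteq> {..n} \<and> length p \<le> n}"
    by (rule finite_lists_length_le) simp
qed

lemma Diff2_star_ge:
  assumes "lam \<in> Diff2_star" and "i < length lam"
  shows "2 * (length lam - i) \<le> lam ! i"
proof -
  have step: "lam ! Suc k + 2 \<le> lam ! k" if "Suc k < length lam" for k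
    using assms(1) that by (auto simp: Diff2_star_def Diff2_def)
  have "0 \<notin> set lam" and "1 \<notin> set lam"
    using assms(1) by (simp_all add: Diff2_star_def Diff2_def is_partition_def)
  have two: "2 \<le> lam ! k" if "k < length lam" for k
  proof -
    have "lam ! k \<in> set lam" using that by (rule nth_mem)
    then have "lam ! k \<noteq> 0" and "lam ! k \<noteq> 1"
      using \<open>0 \<notin> set lam\<close> \<open>1 \<notin> set lam\<close> by metis+
    then show ?thesis by linarith
  qed
  from assms(2) show ?thesis
  proof (induction "length lam - Suc i" arbitrary: i)
    case 0
    then have "length lam - i = 1" by simp
    with two[OF 0(2)] show ?case by simp
  next
    case (Suc d)
    then have "Suc i < length lam" and "d = length lam - Suc (Suc i)" by simp_all
    with Suc(1)[of "Suc i"] step[of i] show ?case by simp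
  qed
qed

end

theory Submission
  imports Defs "HOL-Computational_Algebra.Formal_Laurent_Series"
begin

text \<open>
  Subtracting the staircase \<open>2m, 2(m-1), \<dots>, 2\<close> and conjugating turns the members of \<open>Diff2_star\<close>
  with \<open>m\<close> parts into partitions with parts at most \<open>m\<close>, so their generating function is
  \<open>q^(m^2+m) / ((1-q)\<dots>(1-q^m))\<close>, and the second Rogers-Ramanujan identity says that the sum over \<open>m\<close>
  counts partitions into parts congruent to 2 or 3 modulo 5. Forbidding the parts 3 and 8 multiplies
  this by \<open>(1-q^3)(1-q^8)\<close>. For \<open>m \<ge> 8\<close> and, since \<open>(1-q^8)/(1-q^4) = 1+q^4\<close>, for \<open>5 \<le> m \<le> 7\<close> the
  factor is absorbed by the condition on \<open>col_star\<close> separately for each \<open>m\<close>; for the remaining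
  \<open>m \<le> 4\<close> one compares rational functions.

  The Rogers-Ramanujan identity is obtained from a polynomial version, proved by Chapman's method:
  both sides satisfy the same pair of recurrences. Together with the finite Jacobi triple product
  this gives the identity modulo every power of \<open>q\<close>.
\<close>

section \<open>Gaussian binomial coefficients\<close>

text \<open>The two finite identities meet in a theta sum. Near the centre a Gaussian coefficient is
  congruent to the inverse of \<open>qfact q K\<close> modulo \<open>X^K\<close>, so the bilateral
  form of the Rogers-Ramanujan sum and the triple product at \<open>p = X^5\<close>,
  \<open>z = -X\<close> both reduce to the sum of \<open>(-1)^j X^(j(5j-3)/2)\<close>, which can
  then be eliminated. Negative powers of \<open>q\<close> occur on the way. Hence the finite
  identities are proved over a field with \<open>q \<noteq> 0\<close>, applied to formal Laurent
  series and pulled back to power series, where coefficients can be compared.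

  The obstacle in the refinement is that for few parts the factor \<open>(1-q^3)(1-q^8)\<close>
  leaves negative coefficients: for \<open>m = 0\<close> the term is this product itself. The
  conditions for \<open>m = 1, ..., 4\<close> must compensate each other, and their irregular shape
  reflects one way to rearrange a rational function into terms with nonnegative
  coefficients.\<close>

fun qbinomial :: "'a::comm_ring_1 \<Rightarrow> nat \<Rightarrow> nat \<Rightarrow> 'a" where
  "qbinomial q n 0 = 1"
| "qbinomial q 0 (Suc k) = 0"
| "qbinomial q (Suc n) (Suc k) = qbinomial q n k + q ^ Suc k * qbinomial q n (Suc k)"

definition qfact :: "'a::comm_ring_1 \<Rightarrow> nat \<Rightarrow> 'a" where
  "qfact q n = (\<Prod>i=1..n. 1 - q ^ i)"

lemma qfact_0 [simp]: "qfact q 0 = 1"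
  by (simp add: qfact_def)

lemma qfact_Suc: "qfact q (Suc n) = qfact q n * (1 - q ^ Suc n)"
  by (simp add: qfact_def)

lemma qbinomial_eq_0 [simp]: "n < k \<Longrightarrow> qbinomial q n k = 0"
  by (induction q n k rule: qbinomial.induct) auto

text \<open>In a general commutative ring \<open>1 - q ^ i\<close> may be a zero divisor, so this
  cross-multiplied relation takes the place of the quotient formula. In the induction,
  \<open>top\<close> and \<open>bot\<close> compare two neighbours in row \<open>n + 1\<close> with
  one common entry of row \<open>n\<close>; chaining them removes that entry.\<close>

lemma qbinomial_ratio:
  "k \<le> n \<Longrightarrow> (1 - q ^ Suc k) * qbinomial q n (Suc k) = (1 - q ^ (n - k)) * qbinomial q n k"
proof (induction n arbitrary: k)
  case 0
  then show ?case by simp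
next
  case (Suc n)
  define a where "a = qbinomial q n"
  have R1: "qbinomial q (Suc n) (Suc l) = a l + q ^ Suc l * a (Suc l)" for l
    by (simp add: a_def)
  have top: "(1 - q ^ (n - l)) * qbinomial q (Suc n) (Suc l) = (1 - q ^ Suc n) * a (Suc l)"
    if "l \<le> n" for l
  proof -
    from that obtain d where d: "n = l + d" using le_Suc_ex by auto
    have IH: "a l - q ^ d * a l = a (Suc l) - q ^ Suc l * a (Suc l)"
      using Suc.IH[OF that] by (simp add: a_def d ring_distribs)
    have "(1 - q ^ d) * (a l + q ^ Suc l * a (Suc l)) =
        (a l - q ^ d * a l) + q ^ Suc l * a (Suc l) - q ^ Suc n * a (Suc l)"
      by (simp add: d power_add algebra_simps)
    also have "\<dots> = (1 - q ^ Suc n) * a (Suc l)"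
      unfolding IH by (simp only: ring_distribs) simp
    finally show ?thesis unfolding R1 by (simp add: d)
  qed
  have bot: "(1 - q ^ Suc k) * qbinomial q (Suc n) (Suc k) = (1 - q ^ Suc n) * a k"
    if "k \<le> n" for k
  proof -
    from that obtain d where d: "n = k + d" using le_Suc_ex by auto
    have IH: "(1 - q ^ Suc k) * a (Suc k) = (1 - q ^ d) * a k"
      using Suc.IH[OF that] by (simp add: a_def d)
    have "(1 - q ^ Suc k) * (a k + q ^ Suc k * a (Suc k)) =
        (1 - q ^ Suc k) * a k + q ^ Suc k * ((1 - q ^ Suc k) * a (Suc k))"
      by (simp only: ring_distribs mult_ac)
    also have "\<dots> = (1 - q ^ Suc n) * a k"
      unfolding IH by (simp add: d power_add algebra_simps)
    finally show ?thesis by (simp only: R1)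
  qed
  show ?case
  proof (cases k)
    case 0
    then show ?thesis using bot[of 0] by (simp add: a_def)
  next
    case (Suc l)
    then show ?thesis using Suc.prems top[of l] bot[of k]
      by (cases "k \<le> n") (simp_all add: a_def)
  qed
qed

lemma qbinomial_Suc_absorb:
  assumes "k \<le> n"
  shows "(1 - q ^ Suc k) * qbinomial q (Suc n) (Suc k) = (1 - q ^ Suc n) * qbinomial q n k"
proof -
  from assms obtain d where d: "n = k + d" using le_Suc_ex by auto
  have "(1 - q ^ Suc k) * qbinomial q (Suc n) (Suc k) =
      (1 - q ^ Suc k) * qbinomial q n k + q ^ Suc k * ((1 - q ^ Suc k) * qbinomial q n (Suc k))"
    by (simp only: qbinomial.simps ring_distribs mult_ac)
  also have "\<dots> = (1 - q ^ Suc n) * qbinomial q n k"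
    unfolding qbinomial_ratio[OF assms] by (simp add: d power_add algebra_simps)
  finally show ?thesis .
qed

text \<open>The ratio relation trades \<open>q ^ Suc k\<close> on one term of the defining Pascal
  rule for \<open>q ^ (n - k)\<close> on the other. Having both rules is what makes the
  cancellations in the recurrences possible.\<close>

lemma qbinomial_Suc_Suc':
  "k \<le> n \<Longrightarrow> qbinomial q (Suc n) (Suc k) = q ^ (n - k) * qbinomial q n k + qbinomial q n (Suc k)"
  using qbinomial_ratio[of k n q] by (simp add: algebra_simps)

lemma qbinomial_self [simp]: "qbinomial q n n = 1"
  by (induction n) auto

lemma qbinomial_symmetric: "k \<le> n \<Longrightarrow> qbinomial q n k = qbinomial q n (n - k)"
proof (induction n arbitrary: k)
  case 0
  then show ?case by simp
next
  case (Suc n)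
  show ?case
  proof (cases k)
    case 0
    then show ?thesis by simp
  next
    case [simp]: (Suc l)
    show ?thesis
    proof (cases "l = n")
      case False
      with Suc.prems have "l < n" by simp
      then obtain d where d: "n = Suc (l + d)" using less_imp_Suc_add by auto
      have "qbinomial q (Suc n) (Suc l) = qbinomial q n l + q ^ Suc l * qbinomial q n (Suc l)"
        by (rule qbinomial.simps)
      also have "\<dots> = qbinomial q n (Suc d) + q ^ Suc l * qbinomial q n d"
        using Suc.IH[of l] Suc.IH[of "Suc l"] by (simp only: d) simp
      also have "\<dots> = qbinomial q (Suc n) (Suc d)"
        using qbinomial_Suc_Suc'[of d n q] by (simp only: d) simp
      finally show ?thesis by (simp add: d del: qbinomial.simps)
    qed simp
  qed
qed

lemma qbinomial_qfact:
  "k \<le> n \<Longrightarrow> qbinomial q n k * (qfact q k * qfact q (n - k)) = qfact q n"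
proof (induction k)
  case 0
  then show ?case by simp
next
  case (Suc k)
  then obtain d where d: "n = Suc (k + d)" using less_imp_Suc_add by (metis Suc_le_eq)
  have "qbinomial q n (Suc k) * (qfact q (Suc k) * qfact q (n - Suc k)) =
      ((1 - q ^ Suc k) * qbinomial q n (Suc k)) * (qfact q k * qfact q d)"
    by (simp add: qfact_Suc d mult_ac)
  also have "\<dots> = qbinomial q n k * (qfact q k * qfact q (n - k))"
    using Suc.prems by (subst qbinomial_ratio) (simp_all add: d qfact_Suc mult_ac del: qbinomial.simps)
  finally show ?case using Suc by (simp del: qbinomial.simps)
qed

text \<open>Integer lower indices are needed for sums over all integers.\<close>

definition qbinom :: "'a::comm_ring_1 \<Rightarrow> nat \<Rightarrow> int \<Rightarrow> 'a" where
  "qbinom q n k = (if k < 0 then 0 else qbinomial q n (nat k))"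

lemma qbinom_eq_0: "k < 0 \<or> k > int n \<Longrightarrow> qbinom q n k = 0"
  by (auto simp: qbinom_def)

lemma qbinom_0: "qbinom q 0 k = (if k = 0 then 1 else 0)"
  using qbinom_eq_0[of k 0 q] by (cases k "0 :: int" rule: linorder_cases) (simp_all add: qbinom_def)

lemma qbinom_symmetric: "qbinom q n k = qbinom q n (int n - k)"
proof (cases "k < 0 \<or> k > int n")
  case True
  then show ?thesis by (subst (1 2) qbinom_eq_0) auto
next
  case False
  then have "nat (int n - k) = n - nat k" by linarith
  then show ?thesis using False qbinomial_symmetric[of "nat k" n q]
    by (simp add: qbinom_def nat_le_iff)
qed

lemma qbinom_Suc1:
  fixes q :: "'a::field"
  shows "qbinom q (Suc n) k = qbinom q n (k - 1) + q powi k * qbinom q n k"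
proof (cases "k \<le> 0")
  case True
  then show ?thesis by (cases "k = 0") (auto simp: qbinom_def)
next
  case False
  then obtain l where k: "k = int (Suc l)" using gr0_conv_Suc zero_less_imp_eq_int by force
  then have "k - 1 = int l" by simp
  then show ?thesis
    by (simp only: qbinom_def k power_int_of_nat nat_int qbinomial.simps) simp
qed

lemma qbinom_Suc2:
  fixes q :: "'a::field"
  shows "qbinom q (Suc n) k = q powi (int n + 1 - k) * qbinom q n (k - 1) + qbinom q n k"
proof -
  have "qbinom q (Suc n) k = qbinom q (Suc n) (int (Suc n) - k)"
    by (rule qbinom_symmetric)
  also have "\<dots> = qbinom q n (int n - k) + q powi (int n + 1 - k) * qbinom q n (int n - (k - 1))"
    using qbinom_Suc1[of q n "int (Suc n) - k"] by (simp add: algebra_simps)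
  also have "\<dots> = q powi (int n + 1 - k) * qbinom q n (k - 1) + qbinom q n k"
    by (subst (3 4) qbinom_symmetric) (rule add.commute)
  finally show ?thesis .
qed

section \<open>Finite forms of the Rogers-Ramanujan identities and of the triple product\<close>

definition rr_S :: "'a::comm_ring_1 \<Rightarrow> nat \<Rightarrow> 'a" where
  "rr_S q n = (\<Sum>m\<le>n. q ^ (m * m) * qbinomial q n m)"

definition rr_T :: "'a::comm_ring_1 \<Rightarrow> nat \<Rightarrow> 'a" where
  "rr_T q n = (\<Sum>m\<le>n. q ^ (m * m + m) * qbinomial q n m)"

text \<open>The second Pascal rule fits because \<open>(m+1)^2 + (n-m) = (m^2+m) + (n+1)\<close>,
  which turns one of its two terms into a term of \<open>rr_T\<close>. Only \<open>rr_T\<close> is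
  wanted in the end; \<open>rr_S\<close>, the finite sum of the first Rogers-Ramanujan identity, is
  carried along because the recurrences are coupled.\<close>

lemma rr_S_Suc: "rr_S q (Suc n) = rr_S q n + q ^ Suc n * rr_T q n"
proof -
  have "rr_S q (Suc n) = 1 + (\<Sum>m\<le>n. q ^ (Suc m * Suc m) * qbinomial q (Suc n) (Suc m))"
    unfolding rr_S_def by (subst sum.atMost_Suc_shift) simp
  also have "(\<Sum>m\<le>n. q ^ (Suc m * Suc m) * qbinomial q (Suc n) (Suc m)) =
      (\<Sum>m\<le>n. q ^ Suc n * (q ^ (m * m + m) * qbinomial q n m) +
         q ^ (Suc m * Suc m) * qbinomial q n (Suc m))"
  proof (intro sum.cong refl)
    fix m assume "m \<in> {..n}"
    then obtain d where d: "n = m + d" using le_Suc_ex by auto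
    show "q ^ (Suc m * Suc m) * qbinomial q (Suc n) (Suc m) =
        q ^ Suc n * (q ^ (m * m + m) * qbinomial q n m) + q ^ (Suc m * Suc m) * qbinomial q n (Suc m)"
      by (subst qbinomial_Suc_Suc') (simp_all add: d power_add algebra_simps del: qbinomial.simps)
  qed
  also have "1 + \<dots> = q ^ Suc n * rr_T q n +
      (1 + (\<Sum>m\<le>n. q ^ (Suc m * Suc m) * qbinomial q n (Suc m)))"
    by (simp only: sum.distrib rr_T_def sum_distrib_left ac_simps)
  also have "1 + (\<Sum>m\<le>n. q ^ (Suc m * Suc m) * qbinomial q n (Suc m)) =
      (\<Sum>m\<le>Suc n. q ^ (m * m) * qbinomial q n m)"
    by (subst sum.atMost_Suc_shift) simp
  also have "\<dots> = rr_S q n" by (simp add: rr_S_def)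
  finally show ?thesis by simp
qed

lemma rr_T_Suc: "rr_T q (Suc n) = q ^ Suc n * rr_S q (Suc n) + (1 - q ^ Suc n) * rr_T q n"
proof -
  have "rr_T q (Suc n) - q ^ Suc n * rr_S q (Suc n) =
      (\<Sum>m\<le>Suc n. q ^ (m * m) * (q ^ m - q ^ Suc n) * qbinomial q (Suc n) m)"
    unfolding rr_S_def rr_T_def sum_distrib_left sum_subtractf[symmetric]
    by (intro sum.cong refl) (simp only: power_add algebra_simps)
  also have "\<dots> = (\<Sum>m\<le>n. q ^ (m * m) * (q ^ m - q ^ Suc n) * qbinomial q (Suc n) m)"
    by simp
  also have "\<dots> = (\<Sum>m\<le>n. (1 - q ^ Suc n) * (q ^ (m * m + m) * qbinomial q n m))"
  proof (intro sum.cong refl)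
    fix m assume "m \<in> {..n}"
    then obtain d where d: "n = m + d" using le_Suc_ex by auto
    \<comment> \<open>Absorption lowers both indices, while the sum keeps \<open>m\<close> fixed.
      Reflecting the lower index on both sides gives a rule that changes the upper index
      only.\<close>
    have "(1 - q ^ Suc d) * qbinomial q (Suc n) (Suc d) = (1 - q ^ Suc n) * qbinomial q n d"
      by (rule qbinomial_Suc_absorb) (simp add: d)
    moreover have "qbinomial q n d = qbinomial q n m"
      using qbinomial_symmetric[of m n q] by (simp add: d)
    moreover have "qbinomial q (Suc n) (Suc d) = qbinomial q (Suc n) m"
      using qbinomial_symmetric[of m "Suc n" q] by (simp add: d del: qbinomial.simps)
    ultimately have *: "(1 - q ^ Suc d) * qbinomial q (Suc n) m = (1 - q ^ Suc n) * qbinomial q n m"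
      by (simp only:)
    have "q ^ (m * m) * (q ^ m - q ^ Suc n) * qbinomial q (Suc n) m =
        q ^ (m * m + m) * ((1 - q ^ Suc d) * qbinomial q (Suc n) m)"
      by (simp add: d power_add algebra_simps del: qbinomial.simps)
    then show "q ^ (m * m) * (q ^ m - q ^ Suc n) * qbinomial q (Suc n) m =
        (1 - q ^ Suc n) * (q ^ (m * m + m) * qbinomial q n m)"
      unfolding * by (simp only: ac_simps)
  qed
  also have "\<dots> = (1 - q ^ Suc n) * rr_T q n"
    by (simp only: rr_T_def sum_distrib_left)
  finally show ?thesis by (simp only: diff_eq_eq ac_simps)
qed

text \<open>
  The bilateral sums are truncated at a bound \<open>L\<close>; for \<open>L \<ge> n + 2\<close> all omitted terms vanish, and
  one fixed \<open>L\<close> serves the whole induction on \<open>n\<close>.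
\<close>

definition bil_S :: "'a::field \<Rightarrow> int \<Rightarrow> nat \<Rightarrow> 'a" where
  "bil_S q L n = (\<Sum>j=-L..L. (-1) powi j * q powi ((5 * j * j + j) div 2) * qbinom q (2 * n) (int n + 2 * j))"

definition bil_T :: "'a::field \<Rightarrow> int \<Rightarrow> nat \<Rightarrow> 'a" where
  "bil_T q L n = (\<Sum>j=-L..L. (-1) powi j * q powi ((5 * j * j - 3 * j) div 2) * qbinom q (2 * n + 1) (int n + 2 * j))"

lemma exponent_shift: "(5 * j * j + j) div 2 = (5 * j * j - 3 * j) div 2 + 2 * (j :: int)"
proof -
  have "5 * j * j + j = (5 * j * j - 3 * j) + (2 * j) * 2" by simp
  then show ?thesis by (metis div_mult_self1 zero_neq_numeral add.commute)
qed

lemma sum_eq_0_antisymmetric: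
  fixes f :: "'b \<Rightarrow> 'a::{idom,ring_char_0}"
  assumes "\<And>j. j \<in> A \<Longrightarrow> h j \<in> A" "\<And>j. j \<in> A \<Longrightarrow> h (h j) = j" "\<And>j. j \<in> A \<Longrightarrow> f (h j) = - f j"
  shows "sum f A = 0"
proof -
  have "sum f A = (\<Sum>j\<in>A. - f j)"
    by (rule sum.reindex_bij_witness[of _ h h]) (use assms in auto)
  then have "2 * sum f A = 0" by (simp add: sum_negf)
  then show ?thesis by simp
qed

lemma powi_neg1_reflect: "(-1) powi (c - j) = (-1) powi c * ((-1) powi j :: 'a::field)"
  by (simp add: power_int_diff power_int_minus_left field_simps)

text \<open>Term by term the recurrence is off by a remainder \<open>r j\<close>; the remainders
  cancel only after summation.\<close>

lemma bil_S_Suc: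
  fixes q :: "'a::{field,ring_char_0}"
  assumes q: "q \<noteq> 0" and L: "int n + 2 \<le> L"
  shows "bil_S q L (Suc n) = bil_S q L n + q ^ Suc n * bil_T q L n"
proof -
  define e where "e j = (5 * j * j - 3 * j) div 2" for j :: int
  define Q where "Q = qbinom q (2 * n)"
  define r where "r j = (-1) powi j * q powi (e j + 4 * j + int n + 1) * Q (int n + 1 + 2 * j)" for j
  have "bil_S q L (Suc n) - bil_S q L n - q ^ Suc n * bil_T q L n = (\<Sum>j=-L..L. r j)"
    unfolding bil_S_def bil_T_def sum_distrib_left sum_subtractf[symmetric]
  proof (intro sum.cong refl)
    fix j assume "j \<in> {-L..L}"
    have b1: "qbinom q (2 * n + 1) (int n + 2 * j) = Q (int n + 2 * j - 1) + q powi (int n + 2 * j) * Q (int n + 2 * j)"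
      using qbinom_Suc1[of q "2 * n" "int n + 2 * j"] by (simp add: Q_def)
    have b1': "qbinom q (2 * n + 1) (int n + 2 * j) = q powi (int n + 1 - 2 * j) * Q (int n + 2 * j - 1) + Q (int n + 2 * j)"
      using qbinom_Suc2[of q "2 * n" "int n + 2 * j"] by (simp add: Q_def algebra_simps)
    have b2: "qbinom q (2 * n + 1) (int n + 1 + 2 * j) = q powi (int n - 2 * j) * Q (int n + 2 * j) + Q (int n + 1 + 2 * j)"
      using qbinom_Suc2[of q "2 * n" "int n + 1 + 2 * j"] by (simp add: Q_def algebra_simps)
    have b3: "qbinom q (2 * Suc n) (int (Suc n) + 2 * j) =
        qbinom q (2 * n + 1) (int n + 2 * j) + q powi (int n + 1 + 2 * j) * qbinom q (2 * n + 1) (int n + 1 + 2 * j)"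
      using qbinom_Suc1[of q "2 * n + 1" "int n + 1 + 2 * j"] by (simp add: algebra_simps)
    have [simp]: "q ^ Suc n = q powi (int n + 1)"
      using power_int_of_nat[of q "Suc n"] by (simp add: add.commute)
    define x y z where "x = Q (int n + 2 * j - 1)" and "y = Q (int n + 2 * j)" and "z = Q (int n + 1 + 2 * j)"
    \<comment> \<open>The coefficient with upper index \<open>2 * n + 1\<close> and lower index
      \<open>int n + 2 * j\<close> enters twice and is expanded by a different Pascal rule each
      time: \<open>b1'\<close> where it comes from \<open>bil_S q L (Suc n)\<close>,
      \<open>b1\<close> where it comes from \<open>bil_T q L n\<close>. With this choice all
      multiples of \<open>x\<close> and \<open>y\<close> cancel.\<close>
    have "q powi (e j + 2 * j) * (q powi (int n + 1 - 2 * j) * x + y + q powi (int n + 1 + 2 * j) * (q powi (int n - 2 * j) * y + z))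
        - q powi (e j + 2 * j) * y - q powi (int n + 1) * (q powi e j * (x + q powi (int n + 2 * j) * y))
        = q powi (e j + 4 * j + int n + 1) * z"
      using q by (simp add: algebra_simps flip: power_int_add)
    then have "(-1) powi j * (q powi (e j + 2 * j) * (q powi (int n + 1 - 2 * j) * x + y + q powi (int n + 1 + 2 * j) * (q powi (int n - 2 * j) * y + z))
        - q powi (e j + 2 * j) * y - q powi (int n + 1) * (q powi e j * (x + q powi (int n + 2 * j) * y)))
        = (-1) powi j * (q powi (e j + 4 * j + int n + 1) * z)"
      by simp
    then show "(-1) powi j * q powi ((5 * j * j + j) div 2) * qbinom q (2 * Suc n) (int (Suc n) + 2 * j) -
       (-1) powi j * q powi ((5 * j * j + j) div 2) * qbinom q (2 * n) (int n + 2 * j) -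
       q ^ Suc n * ((-1) powi j * q powi ((5 * j * j - 3 * j) div 2) * qbinom q (2 * n + 1) (int n + 2 * j)) = r j"
      unfolding b3 b1' b2 exponent_shift e_def[symmetric] r_def Q_def[symmetric]
      unfolding b1[unfolded b1'] x_def[symmetric] y_def[symmetric] z_def[symmetric]
      using b1 b1' by (simp only: x_def y_def z_def right_diff_distrib mult_ac \<open>q ^ Suc n = _\<close>)
  qed
  \<comment> \<open>The reflection used next is centred at -1/2, so the interval has to lose its
    right end; the Gaussian coefficient there is zero.\<close>
  also have "\<dots> = (\<Sum>j=-L..L - 1. r j)"
    using L by (intro sum.mono_neutral_right) (auto simp: r_def Q_def qbinom_eq_0)
  also have "\<dots> = 0" \<comment> \<open>the reflection \<open>j \<mapsto> -1 - j\<close> changes the sign of every term\<close>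
  proof (rule sum_eq_0_antisymmetric[where h = "\<lambda>j. -1 - j"])
    fix j assume "j \<in> {-L..L - 1}"
    have "5 * (-1 - j) * (-1 - j) - 3 * (-1 - j) = (5 * j * j - 3 * j) + (8 * j + 4) * 2"
      by (simp add: algebra_simps)
    then have "e (-1 - j) = e j + (8 * j + 4)"
      unfolding e_def by (simp only: div_mult_self1)
    then have "e (-1 - j) + 4 * (-1 - j) = e j + 4 * j" by simp
    moreover have "Q (int n + 1 + 2 * (-1 - j)) = Q (int n + 1 + 2 * j)"
      unfolding Q_def by (subst qbinom_symmetric) (simp add: algebra_simps)
    ultimately show "r (-1 - j) = - r j"
      by (simp only: r_def powi_neg1_reflect) simp
  qed auto
  finally show ?thesis by (simp add: algebra_simps)
qed

text \<open>Here the remainder consists of two families \<open>u\<close> and \<open>v\<close>, which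
  the reflection \<open>j \<mapsto> 1 - j\<close> exchanges up to sign. It moves the interval by
  one, but the terms entering and leaving are zero.\<close>

lemma bil_T_Suc:
  fixes q :: "'a::{field,ring_char_0}"
  assumes q: "q \<noteq> 0" and L: "int n + 2 \<le> L"
  shows "bil_T q L (Suc n) = q ^ Suc n * bil_S q L (Suc n) + (1 - q ^ Suc n) * bil_T q L n"
proof -
  define e where "e j = (5 * j * j - 3 * j) div 2" for j :: int
  define Q where "Q = qbinom q (2 * n + 1)"
  define u v where "u j = (-1) powi j * q powi (e j + 1 - 2 * j) * Q (int n + 2 * j - 1)"
    and "v j = (-1) powi j * q powi (e j) * Q (int n + 2 * j)" for j
  have qn: "q ^ Suc n = q powi (int n + 1)"
    using power_int_of_nat[of q "Suc n"] by (simp add: add.commute)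
  have "bil_T q L (Suc n) - q ^ Suc n * bil_S q L (Suc n) - (1 - q ^ Suc n) * bil_T q L n =
      (\<Sum>j=-L..L. q ^ Suc n * (u j + v j))"
    unfolding bil_S_def bil_T_def sum_distrib_left sum_subtractf[symmetric]
  proof (intro sum.cong refl)
    fix j assume "j \<in> {-L..L}"
    have b1: "qbinom q (2 * Suc n + 1) (int (Suc n) + 2 * j) = qbinom q (2 * Suc n) (int n + 2 * j) + q powi (int n + 1 + 2 * j) * qbinom q (2 * Suc n) (int (Suc n) + 2 * j)"
      using qbinom_Suc1[of q "2 * Suc n" "int (Suc n) + 2 * j"] by (simp add: algebra_simps)
    have b2: "qbinom q (2 * Suc n) (int n + 2 * j) = q powi (int n + 2 - 2 * j) * Q (int n + 2 * j - 1) + Q (int n + 2 * j)"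
      using qbinom_Suc2[of q "2 * n + 1" "int n + 2 * j"] by (simp add: Q_def algebra_simps)
    define x y z where "x = Q (int n + 2 * j - 1)" and "y = Q (int n + 2 * j)"
      and "z = qbinom q (2 * Suc n) (int (Suc n) + 2 * j)"
    have "q powi e j * (q powi (int n + 2 - 2 * j) * x + y + q powi (int n + 1 + 2 * j) * z)
        - q powi (int n + 1) * (q powi (e j + 2 * j) * z) - (1 - q powi (int n + 1)) * (q powi e j * y)
        = q powi (int n + 1) * (q powi (e j + 1 - 2 * j) * x + q powi e j * y)"
      using q by (simp add: algebra_simps flip: power_int_add)
    then have "(-1) powi j * (q powi e j * (q powi (int n + 2 - 2 * j) * x + y + q powi (int n + 1 + 2 * j) * z)
        - q powi (int n + 1) * (q powi (e j + 2 * j) * z) - (1 - q powi (int n + 1)) * (q powi e j * y))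
        = (-1) powi j * (q powi (int n + 1) * (q powi (e j + 1 - 2 * j) * x + q powi e j * y))"
      by (simp only:)
    then show "(-1) powi j * q powi ((5 * j * j - 3 * j) div 2) * qbinom q (2 * Suc n + 1) (int (Suc n) + 2 * j) -
       q ^ Suc n * ((-1) powi j * q powi ((5 * j * j + j) div 2) * qbinom q (2 * Suc n) (int (Suc n) + 2 * j)) -
       (1 - q ^ Suc n) * ((-1) powi j * q powi ((5 * j * j - 3 * j) div 2) * qbinom q (2 * n + 1) (int n + 2 * j)) =
       q ^ Suc n * (u j + v j)"
      unfolding b1 b2 exponent_shift e_def[symmetric] u_def v_def Q_def[symmetric] qn
        x_def[symmetric] y_def[symmetric] z_def[symmetric]
      by (simp only: right_diff_distrib distrib_left distrib_right mult_ac)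
  qed
  also have "\<dots> = q ^ Suc n * ((\<Sum>j=-L..L. u j) + (\<Sum>j=-L..L. v j))"
    by (simp only: sum_distrib_left[symmetric] sum.distrib)
  also have "(\<Sum>j=-L..L. u j) = (\<Sum>j=1-L..1+L. - v j)"
  proof (rule sum.reindex_bij_witness[where i = "\<lambda>j. 1 - j" and j = "\<lambda>j. 1 - j"])
    fix j assume "j \<in> {-L..L}"
    have "e (1 - j) = e j + 1 - 2 * j"
    proof -
      have "5 * (1 - j) * (1 - j) - 3 * (1 - j) = (5 * j * j - 3 * j) + (1 - 2 * j) * 2"
        by (simp add: algebra_simps)
      then show ?thesis unfolding e_def by (simp only: div_mult_self1)
    qed
    moreover have "Q (int n + 2 * (1 - j)) = Q (int n + 2 * j - 1)"
      unfolding Q_def by (subst qbinom_symmetric) (simp add: algebra_simps)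
    ultimately show "- v (1 - j) = u j"
      by (simp add: u_def v_def powi_neg1_reflect)
  qed auto
  also have "\<dots> = (\<Sum>j=-L..L. - v j)"
    using L by (intro sum.mono_neutral_cong) (auto simp: v_def Q_def qbinom_eq_0)
  finally show ?thesis by (simp add: sum_negf algebra_simps)
qed

theorem finite_rogers_ramanujan:
  fixes q :: "'a::{field,ring_char_0}"
  assumes q: "q \<noteq> 0" and "int n + 2 \<le> L"
  shows "rr_S q n = bil_S q L n \<and> rr_T q n = bil_T q L n"
  using assms(2)
proof (induction n)
  case 0
  have "bil_S q L 0 = (\<Sum>j\<in>{0}. (-1) powi j * q powi ((5 * j * j + j) div 2) * qbinom q 0 (2 * j))"
    unfolding bil_S_def using 0
    by (intro sum.mono_neutral_cong_right) (auto simp: qbinom_0)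
  moreover have "bil_T q L 0 = (\<Sum>j\<in>{0}. (-1) powi j * q powi ((5 * j * j - 3 * j) div 2) * qbinom q 1 (2 * j))"
    unfolding bil_T_def using 0 by (intro sum.mono_neutral_cong_right) (auto simp: qbinom_def)
  ultimately show ?case by (simp add: rr_S_def rr_T_def qbinom_def)
next
  case (Suc n)
  then show ?case
    using bil_S_Suc[OF q, of n L] bil_T_Suc[OF q, of n L] by (simp add: rr_S_Suc rr_T_Suc del: power_Suc)
qed

text \<open>Each of the two new factors raises the upper index of the Gaussian coefficients by one:
  \<open>1 + z * p ^ n\<close> corresponds to the second Pascal rule,
  \<open>1 + p ^ Suc n / z\<close> to the first.\<close>

lemma finite_triple_product:
  fixes p z :: "'a::field"
  assumes p: "p \<noteq> 0" and z: "z \<noteq> 0" and "int n + 2 \<le> L"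
  shows "(\<Prod>i<n. (1 + z * p ^ i) * (1 + p ^ Suc i / z)) =
    (\<Sum>j=-L..L. z powi j * p powi (j * (j - 1) div 2) * qbinom p (2 * n) (int n + j))"
  using assms(3)
proof (induction n)
  case 0
  have "(\<Sum>j=-L..L. z powi j * p powi (j * (j - 1) div 2) * qbinom p 0 j) =
      (\<Sum>j\<in>{0}. z powi j * p powi (j * (j - 1) div 2) * qbinom p 0 j)"
    using 0 by (intro sum.mono_neutral_right) (auto simp: qbinom_0)
  then show ?case by (simp add: qbinom_def)
next
  case (Suc n)
  define e where "e j = j * (j - 1) div 2" for j :: int
  have e: "e (j + 1) = e j + j" for j
  proof -
    have "(j + 1) * (j + 1 - 1) = j * (j - 1) + j * 2" by (simp add: algebra_simps)
    then show ?thesis unfolding e_def by (simp only: div_mult_self1)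
  qed
  define f where "f m k j = z powi j * p powi (e j) * qbinom p m (k + j)" for m k j
  have pn: "p ^ n = p powi (int n)" "p ^ Suc n = p powi (int n + 1)"
    using power_int_of_nat[of p "Suc n"] by (simp_all add: add.commute)
  \<comment> \<open>A factor \<open>z\<close> or \<open>1 / z\<close> moves the summation index by
    one; only two boundary terms enter or leave the fixed window.\<close>
  have shift: "(\<Sum>j=-L..L. g (j - 1)) = (\<Sum>j=-L..L. g j)" if "g L = 0" "g (-L - 1) = 0" for g :: "int \<Rightarrow> 'a"
  proof -
    have "(\<Sum>j=-L..L. g (j - 1)) = (\<Sum>j=-L-1..L-1. g j)"
      by (rule sum.reindex_bij_witness[where i = "\<lambda>j. j + 1" and j = "\<lambda>j. j - 1"]) auto
    also have "\<dots> = (\<Sum>j=-L..L. g j)"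
    proof (rule sum.mono_neutral_cong)
      fix i assume "i \<in> {-L..L} - {-L-1..L-1}"
      then have "i = L" by (simp only: Diff_iff atLeastAtMost_iff) linarith
      then show "g i = 0" using that(1) by (simp only:)
    next
      fix i assume "i \<in> {-L-1..L-1} - {-L..L}"
      then have "i = -L - 1" by (simp only: Diff_iff atLeastAtMost_iff) linarith
      then show "g i = 0" using that(2) by (simp only:)
    qed (rule finite_atLeastAtMost_int refl)+
    finally show ?thesis .
  qed
  have 1: "(\<Sum>j=-L..L. f (2 * n) (int n) j) * (1 + z * p ^ n) = (\<Sum>j=-L..L. f (2 * n + 1) (int n) j)"
  proof -
    have "(\<Sum>j=-L..L. f (2 * n + 1) (int n) j) =
        (\<Sum>j=-L..L. f (2 * n) (int n) j + z * p ^ n * f (2 * n) (int n) (j - 1))"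
    proof (intro sum.cong refl)
      fix j
      have b: "qbinom p (2 * n + 1) (int n + j) =
          p powi (int n + 1 - j) * qbinom p (2 * n) (int n + (j - 1)) + qbinom p (2 * n) (int n + j)"
        using qbinom_Suc2[of p "2 * n" "int n + j"] by (simp add: algebra_simps)
      have "z powi j = z * z powi (j - 1)" using z power_int_add[of z 1 "j - 1"] by simp
      moreover have "p powi (e j) * p powi (int n + 1 - j) = p ^ n * p powi (e (j - 1))"
      proof -
        have "e j + (int n + 1 - j) = int n + e (j - 1)" using e[of "j - 1"] by simp
        then show ?thesis unfolding pn using p by (metis power_int_add)
      qed
      ultimately show "f (2 * n + 1) (int n) j = f (2 * n) (int n) j + z * p ^ n * f (2 * n) (int n) (j - 1)"
        unfolding f_def b by (simp add: algebra_simps)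
    qed
    also have "\<dots> = (\<Sum>j=-L..L. f (2 * n) (int n) j) + z * p ^ n * (\<Sum>j=-L..L. f (2 * n) (int n) (j - 1))"
      by (simp only: sum.distrib sum_distrib_left)
    also have "(\<Sum>j=-L..L. f (2 * n) (int n) (j - 1)) = (\<Sum>j=-L..L. f (2 * n) (int n) j)"
      using Suc.prems by (intro shift) (auto simp: f_def qbinom_eq_0)
    finally show ?thesis by (simp add: algebra_simps)
  qed
  have 2: "(\<Sum>j=-L..L. f (2 * n + 1) (int n) j) * (1 + p ^ Suc n / z) =
      (\<Sum>j=-L..L. f (2 * Suc n) (int (Suc n)) j)"
  proof -
    define g where "g j = p ^ Suc n / z * f (2 * n + 1) (int n) (j + 1)" for j
    have "(\<Sum>j=-L..L. f (2 * Suc n) (int (Suc n)) j) = (\<Sum>j=-L..L. f (2 * n + 1) (int n) j + g j)"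
    proof (intro sum.cong refl)
      fix j
      have b: "qbinom p (2 * Suc n) (int (Suc n) + j) =
          qbinom p (2 * n + 1) (int n + j) + p powi (int n + 1 + j) * qbinom p (2 * n + 1) (int n + (j + 1))"
        using qbinom_Suc1[of p "2 * n + 1" "int (Suc n) + j"] by (simp add: algebra_simps)
      define c where "c = qbinom p (2 * n + 1) (int n + (j + 1))"
      have z': "z powi (j + 1) = z powi j * z" using z by (simp add: power_int_add)
      have "e j + (int n + 1 + j) = (int n + 1) + e (j + 1)" using e[of j] by simp
      then have p': "p powi (e j) * p powi (int n + 1 + j) = p ^ Suc n * p powi (e (j + 1))"
        unfolding pn using p by (metis power_int_add)
      have "p ^ Suc n / z * (z powi (j + 1) * p powi e (j + 1) * c) = z powi j * (p ^ Suc n * p powi e (j + 1)) * c"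
        unfolding z' using z by (simp add: mult_ac)
      also have "\<dots> = z powi j * p powi e j * (p powi (int n + 1 + j) * c)"
        unfolding p'[symmetric] by (simp only: mult.assoc)
      finally show "f (2 * Suc n) (int (Suc n)) j = f (2 * n + 1) (int n) j + g j"
        unfolding f_def b g_def c_def[symmetric] by (simp only: distrib_left)
    qed
    also have "\<dots> = (\<Sum>j=-L..L. f (2 * n + 1) (int n) j) + (\<Sum>j=-L..L. g (j - 1))"
      using Suc.prems by (subst shift) (auto simp: g_def f_def qbinom_eq_0 sum.distrib)
    also have "\<dots> = (\<Sum>j=-L..L. f (2 * n + 1) (int n) j) * (1 + p ^ Suc n / z)"
      by (simp only: g_def diff_add_cancel sum_distrib_left[symmetric] distrib_left distrib_right
        mult_1_left mult_1_right mult.commute)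
    finally show ?thesis by simp
  qed
  have "(\<Prod>i<Suc n. (1 + z * p ^ i) * (1 + p ^ Suc i / z)) =
      (\<Sum>j=-L..L. f (2 * n) (int n) j) * (1 + z * p ^ n) * (1 + p ^ Suc n / z)"
    using Suc by (simp add: f_def e_def mult_ac)
  then show ?case unfolding 1 2 by (simp only: f_def[abs_def] e_def)
qed

section \<open>The second Rogers-Ramanujan identity\<close>

text \<open>Congruence modulo \<open>X^K\<close>, which replaces the passage to the limit.\<close>

definition agree :: "nat \<Rightarrow> 'a::comm_ring_1 fps \<Rightarrow> 'a fps \<Rightarrow> bool" where
  "agree K f g \<longleftrightarrow> (\<forall>i<K. fps_nth f i = fps_nth g i)"

lemma agree_refl [simp]: "agree K f f"
  by (simp add: agree_def)

lemma agree_sym: "agree K f g \<Longrightarrow> agree K g f"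
  by (simp add: agree_def)

lemma agree_trans [trans]: "agree K f g \<Longrightarrow> agree K g h \<Longrightarrow> agree K f h"
  by (simp add: agree_def)

lemma agree_mult: "agree K f f' \<Longrightarrow> agree K g g' \<Longrightarrow> agree K (f * g) (f' * g')"
  by (auto simp: agree_def fps_mult_nth intro!: sum.cong)

lemma agree_sum: "(\<And>x. x \<in> A \<Longrightarrow> agree K (f x) (g x)) \<Longrightarrow> agree K (sum f A) (sum g A)"
  by (auto simp: agree_def fps_sum_nth intro!: sum.cong)

lemma agree_sum_subset:
  assumes "finite B" "A \<subseteq> B" "\<And>x. x \<in> B - A \<Longrightarrow> agree K (f x) 0"
  shows "agree K (sum f B) (sum f A)"
  using assms by (auto simp: agree_def fps_sum_nth intro!: sum.mono_neutral_right)

lemma agree_cancel: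
  fixes a :: "'a::field fps"
  assumes "agree K (a * f) (a * g)" "fps_nth a 0 \<noteq> 0"
  shows "agree K f g"
proof -
  have "inverse a * (a * h) = h" for h
    by (simp only: mult.assoc[symmetric] inverse_mult_eq_1[OF assms(2)] mult_1_left)
  then show ?thesis using agree_mult[OF agree_refl[of K "inverse a"] assms(1)] by (simp only:)
qed

lemma agree_fps_X_power: "K \<le> e \<Longrightarrow> agree K (fps_X ^ e * f) 0"
  by (simp add: agree_def fps_X_power_mult_nth)

text \<open>A factor of index \<open>i > a\<close> has \<open>d * i \<ge> K\<close> and is therefore
  congruent to 1. Any sufficiently long q-factorial thus stands in for the infinite product.\<close>

lemma agree_qfact:
  assumes "d \<ge> 1" "K \<le> Suc a" "K \<le> Suc b"
  shows "agree K (qfact (fps_X ^ d :: 'a::comm_ring_1 fps) a) (qfact (fps_X ^ d) b)"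
proof -
  have *: "agree K (qfact (fps_X ^ d :: 'a fps) a) (qfact (fps_X ^ d) b)" if "a \<le> b" "K \<le> Suc a" for a b
    using that(1)
  proof (induction rule: dec_induct)
    case (step n)
    have "Suc n \<le> d * Suc n" using assms(1) by (cases d) auto
    with step.hyps that have "K \<le> d * Suc n" by linarith
    then have "agree K (fps_X ^ (d * Suc n) * 1) (0 :: 'a fps)"
      by (rule agree_fps_X_power)
    then have "fps_nth ((fps_X ^ d) ^ Suc n) i = (0 :: 'a)" if "i < K" for i
      using that by (simp only: agree_def power_mult mult_1_right fps_zero_nth)
    then have "agree K 1 (1 - (fps_X ^ d) ^ Suc n :: 'a fps)"
      by (simp only: agree_def fps_sub_nth) simp
    from agree_mult[OF step.IH this] show ?case by (simp only: qfact_Suc mult_1_right)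
  qed simp
  show ?thesis using *[of a b] agree_sym[OF *[of b a]] assms by (cases "a \<le> b") auto
qed

lemma qfact_nth_0: "d \<ge> 1 \<Longrightarrow> fps_nth (qfact (fps_X ^ d) n :: 'a::comm_ring_1 fps) 0 = 1"
  using agree_qfact[of d 1 n 0, where ?'a = 'a] by (simp add: agree_def)

text \<open>In the quotient formula all three q-factorials are congruent to
  \<open>qfact (fps_X ^ d) K\<close>, so a single inverse of it remains. This replaces the limit of
  central Gaussian coefficients by a congruence.\<close>

lemma agree_qbinomial:
  fixes d K N k :: nat
  assumes "d \<ge> 1" "K \<le> k" "K + k \<le> N"
  shows "agree K (qbinomial (fps_X ^ d) N k * qfact (fps_X ^ d) K) (1 :: 'a::field fps)"
proof (rule agree_cancel)
  let ?q = "fps_X ^ d :: 'a fps"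
  have "agree K (qfact ?q K * (qbinomial ?q N k * qfact ?q K)) (qbinomial ?q N k * (qfact ?q k * qfact ?q (N - k)))"
    unfolding mult.left_commute[of "qfact ?q K"]
    using assms by (intro agree_mult agree_refl agree_qfact) auto
  also have "qbinomial ?q N k * (qfact ?q k * qfact ?q (N - k)) = qfact ?q N"
    using assms by (intro qbinomial_qfact) auto
  also have "agree K (qfact ?q N) (qfact ?q K * 1)"
    using assms by (simp add: agree_qfact)
  finally show "agree K (qfact ?q K * (qbinomial ?q N k * qfact ?q K)) (qfact ?q K * 1)" .
qed (use assms in \<open>simp add: qfact_nth_0\<close>)

lemma agree_qbinom:
  assumes "d \<ge> 1" "int K \<le> k" "int K + k \<le> int N"
  shows "agree K (qbinom (fps_X ^ d) N k * qfact (fps_X ^ d) K) (1 :: 'a::field fps)"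
proof -
  have "K \<le> nat k" "K + nat k \<le> N" using assms by linarith+
  then show ?thesis using agree_qbinomial[of d K "nat k" N, where ?'a = 'a] assms
    by (simp add: qbinom_def)
qed

text \<open>The generalized heptagonal numbers. The conversion by \<open>nat\<close> loses nothing
  because \<open>j(5j-3)/2\<close> is never negative.\<close>

definition pent :: "int \<Rightarrow> nat" where
  "pent j = nat ((5 * j * j - 3 * j) div 2)"

lemma abs_le_pent: "\<bar>j\<bar> \<le> (5 * j * j - 3 * j) div (2 :: int)"
proof -
  have "\<bar>j\<bar> \<le> j * j"
    using mult_mono[of 1 "\<bar>j\<bar>" "\<bar>j\<bar>" "\<bar>j\<bar>"] by (cases "j = 0") (auto simp flip: abs_mult)
  then have "2 * \<bar>j\<bar> \<le> 5 * j * j - 3 * j" by (simp add: abs_if split: if_splits)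
  then show ?thesis by linarith
qed

lemma int_pent: "int (pent j) = (5 * j * j - 3 * j) div 2"
  using abs_le_pent[of j] by (simp add: pent_def)

text \<open>Terms with \<open>\<bar>j\<bar> \<ge> K\<close> vanish on both sides since the exponent
  is at least \<open>\<bar>j\<bar>\<close>. For the others the lower index \<open>n + a * j\<close>
  is at least \<open>n - 2 * K\<close> away from both ends of \<open>0..N\<close>; this explains
  \<open>3 * K \<le> n\<close>. The slope \<open>a\<close> is 2 for the Rogers-Ramanujan sum and 1
  for the triple product.\<close>

lemma agree_bilateral:
  fixes s :: "int \<Rightarrow> 'a::field fps" and a :: int
  assumes "d \<ge> 1" "1 \<le> a" "a \<le> 2" "3 * K \<le> n" "2 * n \<le> N"
  shows "agree K ((\<Sum>j=-L..L. s j * fps_X ^ pent j * qbinom (fps_X ^ d) N (int n + a * j)) * qfact (fps_X ^ d) K)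
    (\<Sum>j=-L..L. s j * fps_X ^ pent j)"
  unfolding sum_distrib_right
proof (rule agree_sum)
  fix j :: int
  show "agree K (s j * fps_X ^ pent j * qbinom (fps_X ^ d) N (int n + a * j) * qfact (fps_X ^ d) K)
    (s j * fps_X ^ pent j)"
  proof (cases "int K \<le> \<bar>j\<bar>")
    case True
    then have K: "K \<le> pent j" using abs_le_pent[of j] int_pent[of j] by linarith
    have "agree K (s j * fps_X ^ pent j * qbinom (fps_X ^ d) N (int n + a * j) * qfact (fps_X ^ d) K) 0"
      using agree_fps_X_power[OF K, of "s j * qbinom (fps_X ^ d) N (int n + a * j) * qfact (fps_X ^ d) K"]
      by (simp only: mult_ac)
    also have "agree K 0 (s j * fps_X ^ pent j)"
      using agree_sym[OF agree_fps_X_power[OF K, of "s j"]] by (simp only: mult_ac)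
    finally show ?thesis .
  next
    case False
    have "\<bar>a * j\<bar> \<le> 2 * \<bar>j\<bar>"
      using assms by (simp add: abs_mult mult_right_mono)
    then have "agree K (qbinom (fps_X ^ d) N (int n + a * j) * qfact (fps_X ^ d) K) (1 :: 'a fps)"
      using assms False by (intro agree_qbinom) linarith+
    from agree_mult[OF agree_refl this, of "s j * fps_X ^ pent j"] show ?thesis
      by (simp add: mult.assoc)
  qed
qed

section \<open>Transfer from Laurent series to power series\<close>

lemma fps_to_fls_sum: "fps_to_fls (sum f A) = (\<Sum>x\<in>A. fps_to_fls (f x))"
  by (induction A rule: infinite_finite_induct) auto

lemma fps_to_fls_prod:
  "fps_to_fls (prod f A) = (\<Prod>x\<in>A. fps_to_fls (f x :: 'a::comm_ring_1 fps))"
  by (induction A rule: infinite_finite_induct) (auto simp: fls_times_fps_to_fls)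

lemma fps_to_fls_qbinomial: "fps_to_fls (qbinomial q n k) = qbinomial (fps_to_fls q) n k"
  by (induction q n k rule: qbinomial.induct) (auto simp: fls_times_fps_to_fls fps_to_fls_power)

lemma fps_to_fls_qbinom: "fps_to_fls (qbinom q n k) = qbinom (fps_to_fls q) n k"
  by (simp add: qbinom_def fps_to_fls_qbinomial)

lemma neg1_powi: "(-1) powi j = ((-1) ^ nat \<bar>j\<bar> :: 'a::field)"
  by (cases "j \<ge> 0") (auto simp: power_int_def power_inverse[symmetric])

text \<open>The exponents \<open>pent j\<close> of the final formula are nonnegative, so the
  identity over Laurent series is the image of one over power series, and the embedding is
  injective.\<close>

lemma rr_T_fps:
  assumes "int n + 2 \<le> L"
  shows "rr_T (fps_X :: 'a::field_char_0 fps) n =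
    (\<Sum>j=-L..L. (-1) ^ nat \<bar>j\<bar> * fps_X ^ pent j * qbinom fps_X (2 * n + 1) (int n + 2 * j))"
proof -
  have "rr_T (fls_X :: 'a fls) n = bil_T fls_X L n"
    using finite_rogers_ramanujan[of "fls_X :: 'a fls" n L] assms by simp
  also have "\<dots> = fps_to_fls (\<Sum>j=-L..L. (-1) ^ nat \<bar>j\<bar> * fps_X ^ pent j * qbinom fps_X (2 * n + 1) (int n + 2 * j))"
    unfolding bil_T_def
    by (simp only: fps_to_fls_sum fps_to_fls_qbinom fls_times_fps_to_fls fps_to_fls_power fps_X_to_fls
      fps_to_fls_uminus fps_one_to_fls neg1_powi power_int_of_nat int_pent[symmetric])
  also have "rr_T (fls_X :: 'a fls) n = fps_to_fls (rr_T fps_X n)"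
    unfolding rr_T_def
    by (simp only: fps_to_fls_sum fps_to_fls_qbinomial fls_times_fps_to_fls fps_to_fls_power fps_X_to_fls)
  finally show ?thesis by simp
qed

text \<open>Taking \<open>p = X^5\<close> and \<open>z = -X\<close> yields the residues 1 and 4
  modulo 5 in the product, and \<open>5 j(j-1)/2 + j = j(5j-3)/2\<close> in the exponent, the same
  as in the bilateral form of \<open>rr_T\<close>.\<close>

lemma triple_product_fps:
  assumes "int n + 2 \<le> L"
  shows "(\<Prod>i<n. (1 - fps_X ^ (5 * i + 1)) * (1 - fps_X ^ (5 * i + 4)) :: 'a::field_char_0 fps) =
    (\<Sum>j=-L..L. (-1) ^ nat \<bar>j\<bar> * fps_X ^ pent j * qbinom (fps_X ^ 5) (2 * n) (int n + j))"
    (is "?l = ?r")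
proof -
  let ?X = "fls_X :: 'a fls"
  have "fps_to_fls ?l = (\<Prod>i<n. (1 + (- ?X) * (?X ^ 5) ^ i) * (1 + (?X ^ 5) ^ Suc i / (- ?X)))"
    unfolding fps_to_fls_prod
  proof (intro prod.cong refl)
    fix i
    have "(?X ^ 5) ^ Suc i = ?X * ?X ^ (5 * i + 4)"
      by (simp flip: power_mult power_Suc add: algebra_simps)
    moreover have "?X * y / (- ?X) = - y" for y
      using nonzero_mult_div_cancel_left[of ?X y] by (simp only: divide_minus_right) simp
    ultimately have "(?X ^ 5) ^ Suc i / (- ?X) = - (?X ^ (5 * i + 4))" by simp
    moreover have "(- ?X) * (?X ^ 5) ^ i = - (?X ^ (5 * i + 1))"
      by (simp add: power_mult)
    ultimately show "fps_to_fls ((1 - fps_X ^ (5 * i + 1)) * (1 - fps_X ^ (5 * i + 4))) =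
        (1 + (- ?X) * (?X ^ 5) ^ i) * (1 + (?X ^ 5) ^ Suc i / (- ?X))"
      by (simp only: fls_times_fps_to_fls fps_to_fls_minus fps_to_fls_power fps_X_to_fls fps_one_to_fls)
         (simp only: diff_conv_add_uminus)
  qed
  also have "\<dots> = (\<Sum>j=-L..L. (- ?X) powi j * (?X ^ 5) powi (j * (j - 1) div 2) * qbinom (?X ^ 5) (2 * n) (int n + j))"
    using assms by (intro finite_triple_product) auto
  also have "\<dots> = fps_to_fls ?r"
    unfolding fps_to_fls_sum
  proof (intro sum.cong refl)
    fix j :: int
    have "even (j * (j - 1))" by simp
    then obtain k where k: "j * (j - 1) = 2 * k" by (elim evenE)
    then have k': "5 * j * j - 3 * j = 2 * (5 * k + j)" by (simp add: algebra_simps)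
    have p: "int (pent j) = j + 5 * k" unfolding int_pent k' by simp
    have "(- ?X) powi j = (-1) powi j * ?X powi j"
      using power_int_mult_distrib[of "-1" ?X j] by simp
    moreover have "?X powi j * (?X ^ 5) powi (j * (j - 1) div 2) = ?X powi (int (pent j))"
      unfolding p k power_int_power by (subst power_int_add) auto
    ultimately have "(- ?X) powi j * (?X ^ 5) powi (j * (j - 1) div 2) = (-1) ^ nat \<bar>j\<bar> * ?X ^ pent j"
      by (simp only: neg1_powi power_int_of_nat mult.assoc)
    then show "(- ?X) powi j * (?X ^ 5) powi (j * (j - 1) div 2) * qbinom (?X ^ 5) (2 * n) (int n + j) =
        fps_to_fls ((-1) ^ nat \<bar>j\<bar> * fps_X ^ pent j * qbinom (fps_X ^ 5) (2 * n) (int n + j))"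
      by (simp only: fps_to_fls_qbinom fls_times_fps_to_fls fps_to_fls_power fps_X_to_fls
      fps_to_fls_uminus fps_one_to_fls)
  qed
  finally show ?thesis by simp
qed

lemma qfact_5_mult:
  "qfact q (5 * n) = (\<Prod>i<n. (1 - q ^ (5 * i + 1)) * (1 - q ^ (5 * i + 4))) *
     (\<Prod>i<n. (1 - q ^ (5 * i + 2)) * (1 - q ^ (5 * i + 3))) * qfact (q ^ 5) n"
proof (induction n)
  case (Suc n)
  have e: "5 * Suc n = Suc (5 * n + 4)" "5 * n + 4 = Suc (5 * n + 3)" "5 * n + 3 = Suc (5 * n + 2)"
    "5 * n + 2 = Suc (5 * n + 1)" "5 * n + 1 = Suc (5 * n)"
    by simp_all
  have "qfact q (5 * Suc n) = qfact q (5 * n) * (1 - q ^ (5 * n + 1)) * (1 - q ^ (5 * n + 2)) *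
      (1 - q ^ (5 * n + 3)) * (1 - q ^ (5 * n + 4)) * (1 - q ^ (5 * Suc n))"
    by (simp only: qfact_Suc[of q "5 * n + 4", folded e(1)] qfact_Suc[of q "5 * n + 3", folded e(2)]
      qfact_Suc[of q "5 * n + 2", folded e(3)] qfact_Suc[of q "5 * n + 1", folded e(4)]
      qfact_Suc[of q "5 * n", folded e(5)])
  also have "q ^ (5 * Suc n) = (q ^ 5) ^ Suc n" by (simp only: power_mult)
  finally show ?case unfolding Suc by (simp only: qfact_Suc prod.lessThan_Suc ac_simps)
qed simp

text \<open>Terms with \<open>m \<ge> K\<close> vanish modulo \<open>X^K\<close>. For
  \<open>m < K\<close> the hypothesis \<open>2 * K \<le> n\<close> leaves
  \<open>n - m \<ge> K\<close>, so the q-factorials of \<open>n\<close> and \<open>n - m\<close> are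
  congruent and cancel from the quotient formula.\<close>

lemma agree_rr_T:
  assumes "2 * K \<le> n" "K \<le> M"
  shows "agree K (rr_T fps_X n) (\<Sum>m\<le>M. fps_X ^ (m * m + m) * inverse (qfact (fps_X :: 'a::field fps) m))"
proof -
  let ?X = "fps_X :: 'a fps"
  have "agree K (rr_T ?X n) (\<Sum>m<K. ?X ^ (m * m + m) * qbinomial ?X n m)"
    unfolding rr_T_def using assms
    by (intro agree_sum_subset agree_fps_X_power) (auto simp: not_less intro: trans_le_add2)
  also have "agree K \<dots> (\<Sum>m<K. ?X ^ (m * m + m) * inverse (qfact ?X m))"
  proof (intro agree_sum agree_mult agree_refl)
    fix m assume m: "m \<in> {..<K}"
    have nz: "fps_nth (qfact ?X m) 0 \<noteq> 0" "fps_nth (qfact ?X n) 0 \<noteq> 0"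
      using qfact_nth_0[of 1 m, where ?'a = 'a] qfact_nth_0[of 1 n, where ?'a = 'a] by auto
    have "agree K (qbinomial ?X n m * (qfact ?X m * qfact ?X n)) (qbinomial ?X n m * (qfact ?X m * qfact ?X (n - m)))"
      using agree_qfact[of 1 K n "n - m", where ?'a = 'a] assms m by (intro agree_mult agree_refl) auto
    also have "\<dots> = qfact ?X n"
      using assms m by (intro qbinomial_qfact) auto
    finally have "agree K (qfact ?X n * (qfact ?X m * qbinomial ?X n m)) (qfact ?X n * 1)"
      by (simp add: mult_ac)
    then have "agree K (qfact ?X m * qbinomial ?X n m) 1"
      using nz by (rule_tac agree_cancel)
    also have "1 = qfact ?X m * inverse (qfact ?X m)"
      using inverse_mult_eq_1'[OF nz(1)] by simp
    finally show "agree K (qbinomial ?X n m) (inverse (qfact ?X m))"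
      using nz by (rule_tac agree_cancel)
  qed
  also have "agree K \<dots> (\<Sum>m\<le>M. ?X ^ (m * m + m) * inverse (qfact ?X m))"
    using assms
    by (intro agree_sym[OF agree_sum_subset] agree_fps_X_power) (auto simp: not_less intro: trans_le_add2)
  finally show ?thesis .
qed

theorem rogers_ramanujan_2:
  assumes "3 * K \<le> n" "K \<le> M"
  shows "agree K ((\<Prod>i<n. (1 - fps_X ^ (5 * i + 2)) * (1 - fps_X ^ (5 * i + 3))) *
    (\<Sum>m\<le>M. fps_X ^ (m * m + m) * inverse (qfact (fps_X :: 'a::field_char_0 fps) m))) 1"
proof -
  let ?X = "fps_X :: 'a fps"
  define P where "P = (\<Prod>i<n. (1 - ?X ^ (5 * i + 1)) * (1 - ?X ^ (5 * i + 4)))"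
  define R where "R = (\<Prod>i<n. (1 - ?X ^ (5 * i + 2)) * (1 - ?X ^ (5 * i + 3)))"
  define \<Theta> where "\<Theta> = (\<Sum>j=-(int n + 2)..int n + 2. (-1) ^ nat \<bar>j\<bar> * ?X ^ pent j)"
  have 1: "agree K (rr_T ?X n * qfact ?X K) \<Theta>"
    unfolding rr_T_fps[OF order_refl] \<Theta>_def
    using agree_bilateral[of 1 2 K n "2 * n + 1" "\<lambda>j. (-1) ^ nat \<bar>j\<bar> :: 'a fps" "int n + 2"] assms by simp
  have 2: "agree K (P * qfact (?X ^ 5) K) \<Theta>"
    unfolding P_def triple_product_fps[OF order_refl] \<Theta>_def
    using agree_bilateral[of 5 1 K n "2 * n" "\<lambda>j. (-1) ^ nat \<bar>j\<bar> :: 'a fps" "int n + 2"] assms by simp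
  \<comment> \<open>The theta sum is eliminated here. The residues 2 and 3 in \<open>R\<close> and
    the multiples of 5 in the q-factorial of \<open>?X ^ 5\<close> complete \<open>P\<close> to
    \<open>qfact ?X (5 * n)\<close>, which is congruent to \<open>qfact ?X K\<close> and
    cancels.\<close>
  have "agree K (qfact ?X K * (R * rr_T ?X n)) (R * (P * qfact (?X ^ 5) K))"
    using agree_mult[OF agree_refl[of K R] agree_trans[OF 1 agree_sym[OF 2]]] by (simp only: mult_ac)
  also have "agree K \<dots> (R * (P * qfact (?X ^ 5) n))"
    using assms by (intro agree_mult agree_refl agree_qfact) auto
  also have "\<dots> = qfact ?X (5 * n)"
    unfolding qfact_5_mult P_def R_def by (simp only: mult_ac)
  also have "agree K \<dots> (qfact ?X K * 1)"
    using agree_qfact[of 1 K "5 * n" K, where ?'a = 'a] assms by simp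
  finally have "agree K (R * rr_T ?X n) 1"
    by (rule agree_cancel) (use qfact_nth_0[of 1 K, where ?'a = 'a] in simp)
  moreover have "agree K (R * rr_T ?X n) (R * (\<Sum>m\<le>M. ?X ^ (m * m + m) * inverse (qfact ?X m)))"
    using assms by (intro agree_mult agree_refl agree_rr_T) auto
  ultimately show ?thesis unfolding R_def by (meson agree_sym agree_trans)
qed

section \<open>Generating functions of partitions with prescribed multiplicities\<close>

lemma mset_eq_imp_eq:
  assumes "sorted_wrt (\<ge>) p" "sorted_wrt (\<ge>) q" "mset p = mset (q :: 'a::linorder list)"
  shows "p = q"
proof -
  have "sorted (rev p)" "sorted (rev q)"
    using assms(1,2) by (simp_all add: sorted_wrt_rev)
  moreover have "mset (rev p) = mset (rev q)" using assms(3) by simp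
  ultimately have "rev p = rev q"
    by (metis sorted_list_of_multiset_mset sorted_sort_id)
  then show ?thesis by simp
qed

definition partition_msets :: "nat set \<Rightarrow> (nat \<Rightarrow> nat \<Rightarrow> bool) \<Rightarrow> nat \<Rightarrow> nat multiset set" where
  "partition_msets S A n =
     {M. set_mset M \<subseteq> S \<and> (\<forall>x\<in>S. A x (count M x)) \<and> sum_mset M = n}"

lemma bij_betw_partition_msets:
  assumes "0 \<notin> S"
  shows "bij_betw mset {p \<in> partitions_of n. set p \<subseteq> S \<and> (\<forall>x\<in>S. A x (count_list p x))}
    (partition_msets S A n)"
proof (rule bij_betwI')
  fix p q assume "p \<in> {p \<in> partitions_of n. set p \<subseteq> S \<and> (\<forall>x\<in>S. A x (count_list p x))}"
    "q \<in> {p \<in> partitions_of n. set p \<subseteq> S \<and> (\<forall>x\<in>S. A x (count_list p x))}"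
  then show "mset p = mset q \<longleftrightarrow> p = q"
    by (auto simp: partitions_of_def is_partition_def intro: mset_eq_imp_eq)
next
  fix p assume "p \<in> {p \<in> partitions_of n. set p \<subseteq> S \<and> (\<forall>x\<in>S. A x (count_list p x))}"
  then show "mset p \<in> partition_msets S A n"
    by (auto simp: partition_msets_def partitions_of_def count_mset sum_mset_sum_list)
next
  fix M assume M: "M \<in> partition_msets S A n"
  define p where "p = rev (sorted_list_of_multiset M)"
  have mp: "mset p = M" by (simp add: p_def)
  have "sorted_wrt (\<ge>) p" by (simp add: p_def sorted_wrt_rev)
  moreover have "set p \<subseteq> S" using M by (simp add: p_def partition_msets_def)
  moreover have "count_list p x = count M x" for x using mp count_mset by metis
  moreover have "sum_list p = n"
    using M sum_mset_sum_list[of p] mp by (simp add: partition_msets_def)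
  ultimately show "\<exists>p\<in>{p \<in> partitions_of n. set p \<subseteq> S \<and> (\<forall>x\<in>S. A x (count_list p x))}. M = mset p"
    using M mp assms by (intro bexI[of _ p]) (auto simp: partition_msets_def partitions_of_def is_partition_def)
qed

lemma finite_partition_msets: "0 \<notin> S \<Longrightarrow> finite (partition_msets S A n)"
  using bij_betw_finite[OF bij_betw_partition_msets[of S n A]] finite_partitions_of[of n] by simp

text \<open>Classifying by the total \<open>k\<close> contributed by the part \<open>x\<close>,
  rather than by its multiplicity, gives the sum the shape of a Cauchy product of power
  series.\<close>

lemma card_partition_msets_insert:
  assumes "0 < x" "x \<notin> S" "0 \<notin> S"
  shows "card (partition_msets (insert x S) A n) =
    (\<Sum>k=0..n. if x dvd k \<and> A x (k div x) then card (partition_msets S A (n - k)) else 0)"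
proof -
  define B where "B k = {M \<in> partition_msets (insert x S) A n. x * count M x = k}" for k
  have fin: "finite (B k)" for k
    using finite_partition_msets[of "insert x S" A n] assms by (simp add: B_def)
  have le: "x * count M x \<le> sum_mset M" for M
  proof -
    have "M = replicate_mset (count M x) x + filter_mset (\<lambda>y. y \<noteq> x) M"
      by (auto simp: multiset_eq_iff)
    then have "sum_mset M = count M x * x + sum_mset (filter_mset (\<lambda>y. y \<noteq> x) M)"
      using sum_mset.union[of "replicate_mset (count M x) x"] by (metis sum_mset_replicate_mset of_nat_id)
    then show ?thesis by (simp add: mult.commute)
  qed
  have "partition_msets (insert x S) A n = (\<Union>k\<in>{0..n}. B k)"
    using le by (fastforce simp: B_def partition_msets_def)
  then have "card (partition_msets (insert x S) A n) = (\<Sum>k=0..n. card (B k))"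
    by (simp only:) (intro card_UN_disjoint; auto simp: fin; auto simp: B_def)
  also have "\<dots> = (\<Sum>k=0..n. if x dvd k \<and> A x (k div x) then card (partition_msets S A (n - k)) else 0)"
  proof (intro sum.cong refl)
    fix k assume k: "k \<in> {0..n}"
    show "card (B k) = (if x dvd k \<and> A x (k div x) then card (partition_msets S A (n - k)) else 0)"
    proof (cases "x dvd k \<and> A x (k div x)")
      case False
      then have "B k = {}" using assms(1) by (auto simp: B_def partition_msets_def)
      then show ?thesis unfolding if_not_P[OF False] by simp
    next
      case True
      then obtain c where c: "k = x * c" "A x c" using assms(1) by auto
      have "bij_betw (filter_mset (\<lambda>y. y \<noteq> x)) (B k) (partition_msets S A (n - k))"
      proof (rule bij_betw_byWitness[where f' = "\<lambda>M. M + replicate_mset c x"])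
        have split: "filter_mset (\<lambda>y. y \<noteq> x) M + replicate_mset c x = M" if "M \<in> B k" for M
        proof -
          have "count M x = c" using that c assms(1) by (simp add: B_def)
          then show ?thesis by (auto simp: multiset_eq_iff)
        qed
        then show "\<forall>M\<in>B k. filter_mset (\<lambda>y. y \<noteq> x) M + replicate_mset c x = M" by blast
        have "x \<notin># M" if "M \<in> partition_msets S A (n - k)" for M
          using that assms(2) by (auto simp: partition_msets_def)
        then show "\<forall>M\<in>partition_msets S A (n - k). filter_mset (\<lambda>y. y \<noteq> x) (M + replicate_mset c x) = M"
          by (auto simp: multiset_eq_iff not_in_iff)
        show "filter_mset (\<lambda>y. y \<noteq> x) ` B k \<subseteq> partition_msets S A (n - k)"
        proof
          fix M' assume "M' \<in> filter_mset (\<lambda>y. y \<noteq> x) ` B k"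
          then obtain M where M: "M \<in> B k" "M' = filter_mset (\<lambda>y. y \<noteq> x) M" by blast
          have "sum_mset M = sum_mset M' + k"
            using arg_cong[OF split[OF M(1)], of sum_mset] M(2) c by (simp add: mult.commute)
          then show "M' \<in> partition_msets S A (n - k)"
            using M assms(2) by (auto simp: B_def partition_msets_def)
        qed
        show "(\<lambda>M. M + replicate_mset c x) ` partition_msets S A (n - k) \<subseteq> B k"
        proof
          fix M' assume "M' \<in> (\<lambda>M. M + replicate_mset c x) ` partition_msets S A (n - k)"
          then obtain M where M: "M \<in> partition_msets S A (n - k)" "M' = M + replicate_mset c x" by blast
          have "count M x = 0" using M assms(2) by (auto simp: partition_msets_def not_in_iff[symmetric])
          moreover have "A y (count M y) \<and> y \<noteq> x" if "y \<in> S" for y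
            using M assms(2) that by (auto simp: partition_msets_def)
          ultimately show "M' \<in> B k"
            using M c k by (auto simp: B_def partition_msets_def mult.commute split: if_splits)
        qed
      qed
      then show ?thesis using True by (simp add: bij_betw_same_card)
    qed
  qed
  finally show ?thesis .
qed

definition mult_gf :: "nat \<Rightarrow> (nat \<Rightarrow> bool) \<Rightarrow> rat fps" where
  "mult_gf x A = Abs_fps (\<lambda>k. if x dvd k \<and> A (k div x) then 1 else 0)"

lemma card_partition_msets:
  assumes "finite S" "0 \<notin> S"
  shows "of_nat (card (partition_msets S A n)) = fps_nth (\<Prod>x\<in>S. mult_gf x (A x)) n"
  using assms
proof (induction S arbitrary: n rule: finite_induct)
  case empty
  have "partition_msets {} A n = (if n = 0 then {{#}} else {})"
    by (auto simp: partition_msets_def)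
  then show ?case by simp
next
  case (insert x S)
  have "of_nat (card (partition_msets (insert x S) A n)) =
      (\<Sum>k=0..n. fps_nth (mult_gf x (A x)) k * of_nat (card (partition_msets S A (n - k))))"
    using insert by (subst card_partition_msets_insert) (auto simp: mult_gf_def intro!: sum.cong)
  also have "\<dots> = (\<Sum>k=0..n. fps_nth (mult_gf x (A x)) k * fps_nth (\<Prod>x\<in>S. mult_gf x (A x)) (n - k))"
    using insert by simp
  also have "\<dots> = fps_nth (\<Prod>x\<in>insert x S. mult_gf x (A x)) n"
    using insert.hyps by (simp add: fps_mult_nth)
  finally show ?case .
qed

lemma card_partitions_gf:
  assumes "finite S" "0 \<notin> S"
  shows "of_nat (card {p \<in> partitions_of n. set p \<subseteq> S \<and> (\<forall>x\<in>S. A x (count_list p x))}) =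
    fps_nth (\<Prod>x\<in>S. mult_gf x (A x)) n"
  using bij_betw_same_card[OF bij_betw_partition_msets[OF assms(2)]] card_partition_msets[OF assms]
  by simp

lemma sum_fps_X_powers_nth:
  assumes "0 < x" "finite I"
  shows "fps_nth (\<Sum>i\<in>I. fps_X ^ (x * i)) n = (if x dvd n \<and> n div x \<in> I then 1 else (0::rat))"
proof -
  have "fps_nth (\<Sum>i\<in>I. fps_X ^ (x * i)) n = (\<Sum>i\<in>I. if x dvd n \<and> n div x = i then 1 else (0::rat))"
    using assms(1) by (auto simp: fps_sum_nth fps_X_power_nth intro!: sum.cong)
  then show ?thesis using assms(2) by (cases "x dvd n") simp_all
qed

lemma mult_gf_finite:
  assumes "0 < x" "finite I" "\<And>i. A i \<longleftrightarrow> i \<in> I"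
  shows "mult_gf x A = (\<Sum>i\<in>I. fps_X ^ (x * i))"
  by (rule fps_ext) (use assms in \<open>simp add: sum_fps_X_powers_nth mult_gf_def\<close>)

text \<open>The product telescopes to a single period. This turns the parity condition and the
  conditions modulo 7 into rational functions.\<close>

lemma mult_gf_periodic:
  assumes "0 < x" "0 < d" "\<And>i. A (i + d) \<longleftrightarrow> A i"
  shows "mult_gf x A * (1 - fps_X ^ (x * d)) = (\<Sum>i | i < d \<and> A i. fps_X ^ (x * i))"
proof (rule fps_ext)
  fix n
  have "fps_nth (mult_gf x A * (1 - fps_X ^ (x * d))) n =
      fps_nth (mult_gf x A) n - (if n < x * d then 0 else fps_nth (mult_gf x A) (n - x * d))"
    by (simp add: right_diff_distrib fps_X_power_mult_right_nth)
  also have "\<dots> = (if x dvd n \<and> n div x \<in> {i. i < d \<and> A i} then 1 else 0)"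
  proof (cases "n < x * d")
    case True
    then have "n div x < d" using assms(1) by (simp add: less_mult_imp_div_less mult.commute)
    then show ?thesis using True by (simp add: mult_gf_def)
  next
    case False
    then obtain r where r: "n = r + x * d" by (metis add.commute le_Suc_ex not_less)
    have "n div x = r div x + d" using assms(1) r by simp
    moreover have "x dvd n \<longleftrightarrow> x dvd r" by (simp add: r dvd_add_left_iff)
    ultimately show ?thesis using False r assms(3) by (simp add: mult_gf_def)
  qed
  also have "\<dots> = fps_nth (\<Sum>i | i < d \<and> A i. fps_X ^ (x * i)) n"
    using assms by (subst sum_fps_X_powers_nth) auto
  finally show "fps_nth (mult_gf x A * (1 - fps_X ^ (x * d))) n = fps_nth (\<Sum>i | i < d \<and> A i. fps_X ^ (x * i)) n" .
qed

lemma mult_gf_True: "0 < x \<Longrightarrow> mult_gf x (\<lambda>_. True) * (1 - fps_X ^ x) = 1"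
  using mult_gf_periodic[of x 1 "\<lambda>_. True"] by simp

section \<open>Removing the staircase and conjugating\<close>

text \<open>One cell of the Young diagram is read in two ways: row \<open>j\<close> reaches column
  \<open>v\<close> exactly if column \<open>v\<close> extends below the first \<open>j\<close> rows.
  This symmetry is what makes conjugation invertible.\<close>

lemma less_length_filter_ge_iff:
  fixes v :: "'a::linorder"
  assumes "sorted_wrt (\<ge>) p"
  shows "j < length (filter (\<lambda>x. v \<le> x) p) \<longleftrightarrow> j < length p \<and> v \<le> p ! j"
  using assms
proof (induction p arbitrary: j)
  case (Cons a p)
  show ?case
  proof (cases "v \<le> a")
    case True
    then show ?thesis using Cons by (cases j) auto
  next
    case False
    then have "filter (\<lambda>x. v \<le> x) p = []"
      using Cons.prems by (auto simp: filter_empty_conv)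
    moreover have "\<not> v \<le> (a # p) ! j" if "j < length (a # p)"
    proof -
      have "(a # p) ! j \<le> a" using Cons.prems nth_mem[OF that] by auto
      then show ?thesis using False order.trans by blast
    qed
    ultimately show ?thesis using False by auto
  qed
qed simp

text \<open>Conjugation with a prescribed number of columns, empty ones included. Since
  \<open>conjugate\<close> ignores zero rows, inverting it requires the intended length.\<close>

definition cols :: "nat \<Rightarrow> nat list \<Rightarrow> nat list" where
  "cols m p = map (\<lambda>i. length (filter (\<lambda>x. Suc i \<le> x) p)) [0..<m]"

lemma length_cols [simp]: "length (cols m p) = m"
  by (simp add: cols_def)

lemma nth_cols [simp]: "i < m \<Longrightarrow> cols m p ! i = length (filter (\<lambda>x. Suc i \<le> x) p)"
  by (simp add: cols_def)

lemma conjugate_eq_cols: "conjugate mu = cols (Max (insert 0 (set mu))) mu"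
  unfolding conjugate_def cols_def One_nat_def map_Suc_upt[symmetric] by simp

lemma length_filter_mono: "(\<And>x. P x \<Longrightarrow> Q x) \<Longrightarrow> length (filter P xs) \<le> length (filter Q xs)"
  by (induction xs) auto

lemma sorted_cols: "sorted_wrt (\<ge>) (cols m p)"
  unfolding sorted_wrt_iff_nth_less by (auto intro!: length_filter_mono)

lemma cols_le: "x \<in> set (cols m p) \<Longrightarrow> x \<le> length p"
  by (auto simp: cols_def)

lemma sum_list_cols: "(\<And>x. x \<in> set p \<Longrightarrow> x \<le> m) \<Longrightarrow> sum_list (cols m p) = sum_list p"
proof (induction p)
  case Nil
  then show ?case by (simp add: cols_def sum_list_triv)
next
  case (Cons a p)
  have "sum_list (cols m (a # p)) = (\<Sum>i\<leftarrow>[0..<m]. of_bool (i < a) + length (filter (\<lambda>x. Suc i \<le> x) p))"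
    unfolding cols_def by (intro arg_cong[of _ _ sum_list] map_cong) auto
  also have "\<dots> = (\<Sum>i\<leftarrow>[0..<m]. of_bool (i < a)) + sum_list (cols m p)"
    by (simp add: sum_list_addf cols_def)
  also have "(\<Sum>i\<leftarrow>[0..<m]. of_bool (i < a)) = (\<Sum>i\<in>{0..<m}. of_bool (i < a))"
    by (simp add: interv_sum_list_conv_sum_set_nat)
  also have "\<dots> = card ({0..<m} \<inter> {i. i < a})"
    by simp
  also have "{0..<m} \<inter> {i. i < a} = {0..<a}" using Cons.prems[of a] by auto
  finally show ?case using Cons by simp
qed

lemma cols_cols:
  assumes "sorted_wrt (\<ge>) p" "\<And>x. x \<in> set p \<Longrightarrow> x \<le> m"
  shows "cols (length p) (cols m p) = p"
proof (rule nth_equalityI)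
  fix i assume "i < length (cols (length p) (cols m p))"
  then have i: "i < length p" by simp
  have "j < cols (length p) (cols m p) ! i \<longleftrightarrow> j < p ! i" for j
  proof -
    have "j < cols (length p) (cols m p) ! i \<longleftrightarrow> j < m \<and> Suc i \<le> cols m p ! j"
      using i less_length_filter_ge_iff[OF sorted_cols[of m p], of j "Suc i"] by simp
    also have "\<dots> \<longleftrightarrow> j < m \<and> i < length p \<and> Suc j \<le> p ! i"
      using less_length_filter_ge_iff[OF assms(1), of i "Suc j"] by auto
    also have "\<dots> \<longleftrightarrow> j < p ! i"
      using i assms(2)[OF nth_mem[OF i]] by auto
    finally show ?thesis .
  qed
  then show "cols (length p) (cols m p) ! i = p ! i"
    by (metis linorder_less_linear less_irrefl)
qed simp

lemma conjugate_cols: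
  assumes "is_partition p" "set p \<subseteq> {1..m}"
  shows "conjugate (cols m p) = p"
proof -
  \<comment> \<open>No part is zero, so the first column counts all of them; hence
    \<open>conjugate\<close> produces exactly \<open>length p\<close> entries.\<close>
  have "Max (insert 0 (set (cols m p))) = length p"
  proof (rule Max_eqI)
    show "length p \<in> insert 0 (set (cols m p))"
    proof (cases "p = []")
      case False
      then have "hd p \<in> {1..m}" using assms(2) hd_in_set by blast
      then have m: "0 < m" by auto
      have "filter (\<lambda>x. Suc 0 \<le> x) p = p" using assms(2) by (auto simp: filter_id_conv)
      then have "cols m p ! 0 = length p" using m by simp
      then show ?thesis using m nth_mem[of 0 "cols m p"] by simp
    qed simp
  qed (auto simp: cols_le)
  moreover have "cols (length p) (cols m p) = p"
    by (rule cols_cols) (use assms in \<open>auto simp: is_partition_def\<close>)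
  ultimately show ?thesis by (simp add: conjugate_eq_cols)
qed

text \<open>Zero entries are permitted on the left, where \<open>m\<close> is the length; on the
  right \<open>m\<close> survives only as a bound on the parts.\<close>

lemma bij_betw_conjugate:
  "bij_betw conjugate {mu. length mu = m \<and> sorted_wrt (\<ge>) mu \<and> sum_list mu = n}
     {p \<in> partitions_of n. set p \<subseteq> {1..m}}"
proof (rule bij_betw_byWitness[where f' = "cols m"])
  show "\<forall>mu\<in>{mu. length mu = m \<and> sorted_wrt (\<ge>) mu \<and> sum_list mu = n}. cols m (conjugate mu) = mu"
    by (auto simp: conjugate_eq_cols intro!: cols_cols)
  show "\<forall>p\<in>{p \<in> partitions_of n. set p \<subseteq> {1..m}}. conjugate (cols m p) = p"
    by (auto simp: partitions_of_def conjugate_cols)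
  show "conjugate ` {mu. length mu = m \<and> sorted_wrt (\<ge>) mu \<and> sum_list mu = n} \<subseteq> {p \<in> partitions_of n. set p \<subseteq> {1..m}}"
  proof clarify
    fix mu :: "nat list" assume mu: "sorted_wrt (\<ge>) mu" "n = sum_list mu" "m = length mu"
    have "x \<noteq> 0" if "x \<in> set (conjugate mu)" for x
    proof -
      from that obtain i where i: "i < Max (insert 0 (set mu))" "x = length (filter (\<lambda>x. Suc i \<le> x) mu)"
        by (auto simp: conjugate_eq_cols cols_def)
      then obtain y where "y \<in> set mu" "i < y" by (auto simp: Max_gr_iff)
      then have "filter (\<lambda>x. Suc i \<le> x) mu \<noteq> []" by (auto simp: filter_empty_conv Suc_le_eq)
      then show ?thesis using i by simp
    qed
    moreover have "x \<le> length mu" if "x \<in> set (conjugate mu)" for x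
      using that cols_le by (auto simp: conjugate_eq_cols)
    moreover have "sum_list (conjugate mu) = sum_list mu"
      by (simp add: conjugate_eq_cols sum_list_cols)
    ultimately show "conjugate mu \<in> partitions_of (sum_list mu) \<and> set (conjugate mu) \<subseteq> {1..length mu}"
      using sorted_cols by (force simp: partitions_of_def is_partition_def conjugate_eq_cols Suc_le_eq)
  qed
  show "cols m ` {p \<in> partitions_of n. set p \<subseteq> {1..m}} \<subseteq> {mu. length mu = m \<and> sorted_wrt (\<ge>) mu \<and> sum_list mu = n}"
    by (auto simp: sorted_cols partitions_of_def intro!: sum_list_cols)
qed

section \<open>The staircase bijection\<close>

definition unstair :: "nat list \<Rightarrow> nat list" where
  "unstair lam = map (\<lambda>i. lam ! i - 2 * (length lam - i)) [0..<length lam]"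

definition stair :: "nat list \<Rightarrow> nat list" where
  "stair mu = map (\<lambda>i. mu ! i + 2 * (length mu - i)) [0..<length mu]"

lemma sum_list_stair: "sum_list (stair mu) = sum_list mu + (length mu * length mu + length mu)"
proof -
  have "sum_list (stair mu) = (\<Sum>i\<in>{0..<length mu}. mu ! i + 2 * (length mu - i))"
    by (simp add: stair_def interv_sum_list_conv_sum_set_nat)
  also have "\<dots> = sum_list mu + (\<Sum>i\<in>{0..<length mu}. 2 * (length mu - i))"
    by (simp add: sum.distrib sum_list_sum_nth)
  also have "(\<Sum>i\<in>{0..<m}. 2 * (m - i)) = m * m + m" for m :: nat
    by (induction m) (simp_all add: sum.atLeast0_lessThan_Suc_shift del: sum.op_ivl_Suc)
  finally show ?thesis .
qed

lemma Diff2_star_iff: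
  "lam \<in> Diff2_star \<longleftrightarrow> (\<forall>i. Suc i < length lam \<longrightarrow> lam ! Suc i + 2 \<le> lam ! i) \<and> (\<forall>x\<in>set lam. 2 \<le> x)"
proof
  assume "lam \<in> Diff2_star"
  then have "\<forall>i. Suc i < length lam \<longrightarrow> lam ! Suc i + 2 \<le> lam ! i" "0 \<notin> set lam" "1 \<notin> set lam"
    by (auto simp: Diff2_star_def Diff2_def is_partition_def)
  moreover have "2 \<le> x \<longleftrightarrow> x \<noteq> 0 \<and> x \<noteq> 1" for x :: nat by auto
  ultimately show "(\<forall>i. Suc i < length lam \<longrightarrow> lam ! Suc i + 2 \<le> lam ! i) \<and> (\<forall>x\<in>set lam. 2 \<le> x)"
    by metis
next
  assume *: "(\<forall>i. Suc i < length lam \<longrightarrow> lam ! Suc i + 2 \<le> lam ! i) \<and> (\<forall>x\<in>set lam. 2 \<le> x)"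
  have "sorted_wrt (\<ge>) lam"
  proof (subst sorted_wrt_iff_nth_Suc_transp)
    show "\<forall>i. Suc i < length lam \<longrightarrow> lam ! Suc i \<le> lam ! i" using * by (meson add_leD1)
  qed (auto simp: transp_def)
  moreover have "0 \<notin> set lam" "1 \<notin> set lam"
    using * bspec[of "set lam" "\<lambda>x. 2 \<le> x" 0] bspec[of "set lam" "\<lambda>x. 2 \<le> x" 1] by auto
  ultimately show "lam \<in> Diff2_star"
    using * by (simp add: Diff2_star_def Diff2_def is_partition_def)
qed

text \<open>The size condition is additive rather than a subtraction from \<open>N\<close>, so that
  it also yields \<open>m * m + m \<le> N\<close> as soon as the left set is nonempty.\<close>

lemma bij_betw_unstair:
  "bij_betw unstair {lam \<in> Diff2_star \<inter> partitions_of N. length lam = m}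
     {mu. length mu = m \<and> sorted_wrt (\<ge>) mu \<and> sum_list mu + (m * m + m) = N}"
proof -
  have inv1: "stair (unstair lam) = lam" if "lam \<in> Diff2_star" for lam
    using Diff2_star_ge[OF that] by (intro nth_equalityI) (simp_all add: stair_def unstair_def)
  have inv2: "unstair (stair mu) = mu" for mu
    by (intro nth_equalityI) (simp_all add: stair_def unstair_def)
  show ?thesis
  proof (rule bij_betw_byWitness[where f' = stair])
    show "unstair ` {lam \<in> Diff2_star \<inter> partitions_of N. length lam = m} \<subseteq>
        {mu. length mu = m \<and> sorted_wrt (\<ge>) mu \<and> sum_list mu + (m * m + m) = N}"
    proof clarify
      fix lam assume lam: "lam \<in> Diff2_star" "lam \<in> partitions_of N" "m = length lam"
      have "sorted_wrt (\<ge>) (unstair lam)"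
      proof (subst sorted_wrt_iff_nth_Suc_transp)
        show "\<forall>i. Suc i < length (unstair lam) \<longrightarrow> unstair lam ! Suc i \<le> unstair lam ! i"
        proof (intro allI impI)
          fix i assume "Suc i < length (unstair lam)"
          then have i: "Suc i < length lam" by (simp add: unstair_def)
          then have "lam ! Suc i + 2 \<le> lam ! i" using lam(1) by (auto simp: Diff2_star_iff)
          then show "unstair lam ! Suc i \<le> unstair lam ! i" using i by (simp add: unstair_def)
        qed
      qed (auto simp: transp_def)
      moreover have "length (unstair lam) = length lam" by (simp add: unstair_def)
      moreover have "sum_list (unstair lam) + (length lam * length lam + length lam) = N"
        using sum_list_stair[of "unstair lam"] inv1[OF lam(1)] lam(2)
        by (simp add: unstair_def partitions_of_def)
      ultimately show "length (unstair lam) = length lam \<and> sorted_wrt (\<ge>) (unstair lam) \<and>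
          sum_list (unstair lam) + (length lam * length lam + length lam) = N" by blast
    qed
    show "stair ` {mu. length mu = m \<and> sorted_wrt (\<ge>) mu \<and> sum_list mu + (m * m + m) = N} \<subseteq>
        {lam \<in> Diff2_star \<inter> partitions_of N. length lam = m}"
    proof clarify
      fix mu :: "nat list"
      assume mu: "sorted_wrt (\<ge>) mu" "m = length mu" "N = sum_list mu + (length mu * length mu + length mu)"
      have "stair mu \<in> Diff2_star"
        unfolding Diff2_star_iff
      proof (intro conjI allI impI ballI)
        fix i assume "Suc i < length (stair mu)"
        then have i: "Suc i < length mu" by (simp add: stair_def)
        then have "mu ! Suc i \<le> mu ! i" using mu(1) by (simp add: sorted_wrt_iff_nth_less)
        then show "stair mu ! Suc i + 2 \<le> stair mu ! i" using i by (simp add: stair_def)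
      next
        fix x assume "x \<in> set (stair mu)"
        then show "2 \<le> x" by (auto simp: stair_def)
      qed
      then show "stair mu \<in> Diff2_star \<inter> partitions_of (sum_list mu + (length mu * length mu + length mu)) \<and>
          length (stair mu) = length mu"
        by (auto simp: partitions_of_def sum_list_stair Diff2_star_def Diff2_def) (simp add: stair_def)
    qed
  qed (auto simp: inv1 inv2)
qed

lemma Diff2_star_size:
  assumes "lam \<in> Diff2_star \<inter> partitions_of N"
  shows "length lam * length lam + length lam \<le> N"
  using bij_betwE[OF bij_betw_unstair[of N "length lam"]] assms by fastforce

lemma bij_betw_col_star:
  assumes "m * m + m \<le> N"
  shows "bij_betw col_star {lam \<in> Diff2_star \<inter> partitions_of N. length lam = m}
    {p \<in> partitions_of (N - (m * m + m)). set p \<subseteq> {1..m}}"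
proof -
  let ?W = "{mu. length mu = m \<and> sorted_wrt (\<ge>) mu \<and> sum_list mu + (m * m + m) = N}"
  have "x + (m * m + m) = N \<longleftrightarrow> x = N - (m * m + m)" for x using assms by linarith
  then have W: "?W = {mu. length mu = m \<and> sorted_wrt (\<ge>) mu \<and> sum_list mu = N - (m * m + m)}"
    by (simp only:)
  have "col_star = conjugate \<circ> unstair"
    by (simp add: fun_eq_iff col_star_def unstair_def)
  then show ?thesis
    using bij_betw_trans[OF bij_betw_unstair[of N m, unfolded W] bij_betw_conjugate] by (simp only:)
qed

lemma card_col_star:
  assumes "m * m + m \<le> N"
  shows "card {lam \<in> Diff2_star \<inter> partitions_of N. length lam = m \<and> Q (col_star lam)} =
    card {p \<in> partitions_of (N - (m * m + m)). set p \<subseteq> {1..m} \<and> Q p}"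
proof -
  let ?D = "{lam \<in> Diff2_star \<inter> partitions_of N. length lam = m}"
  let ?P = "{p \<in> partitions_of (N - (m * m + m)). set p \<subseteq> {1..m}}"
  note bij = bij_betw_col_star[OF assms]
  have "bij_betw col_star {lam \<in> ?D. Q (col_star lam)} {p \<in> ?P. Q p}"
  proof (rule bij_betw_subset[OF bij])
    have "f ` {x \<in> A. Q (f x)} = {y \<in> f ` A. Q y}" for f :: "nat list \<Rightarrow> nat list" and A by blast
    then show "col_star ` {lam \<in> ?D. Q (col_star lam)} = {p \<in> ?P. Q p}"
      by (simp only: bij_betw_imp_surj_on[OF bij])
  qed blast
  from bij_betw_same_card[OF this] have "card {lam \<in> ?D. Q (col_star lam)} = card {p \<in> ?P. Q p}" .
  moreover have "{lam \<in> ?D. Q (col_star lam)} = {lam \<in> Diff2_star \<inter> partitions_of N. length lam = m \<and> Q (col_star lam)}"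
    "{p \<in> ?P. Q p} = {p \<in> partitions_of (N - (m * m + m)). set p \<subseteq> {1..m} \<and> Q p}"
    by blast+
  ultimately show ?thesis by (simp only:)
qed

lemma col_star_partition:
  assumes "lam \<in> Diff2_star \<inter> partitions_of N"
  shows "is_partition (col_star lam)" "set (col_star lam) \<subseteq> {1..length lam}"
  using bij_betwE[OF bij_betw_col_star[OF Diff2_star_size[OF assms]]] assms
  by (auto simp: partitions_of_def)

section \<open>The refined identity\<close>

text \<open>All conditions restrict the multiplicities of the part sizes independently, so each
  \<open>m\<close> contributes a product with one factor per size. For \<open>m = 1\<close> the
  partition \<open>[a]\<close> leaves \<open>a - 2\<close> ones, which turns the parity of the part
  into that of a multiplicity.\<close>

definition allowed :: "nat \<Rightarrow> nat \<Rightarrow> nat \<Rightarrow> bool" where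
  "allowed m x i \<longleftrightarrow>
    (if 8 \<le> m then x \<in> {3, 8} \<longrightarrow> i = 0
     else if 5 \<le> m then (x = 3 \<longrightarrow> i = 0) \<and> (x = 4 \<longrightarrow> i \<le> 1)
     else if m = 4 then (x = 4 \<longrightarrow> i = 0) \<and> (x = 3 \<longrightarrow> i \<le> 2) \<and> (x = 1 \<longrightarrow> i mod 7 \<in> {2, 3, 4})
     else if m = 3 then (x = 3 \<longrightarrow> i = 0) \<and> (x = 1 \<longrightarrow> i mod 7 \<notin> {3, 4})
     else if m = 2 then x = 1 \<longrightarrow> i = 1
     else even i)"

lemma eq_part321_iff:
  assumes "is_partition p"
  shows "p = part321 j k l \<longleftrightarrow>
    set p \<subseteq> {1, 2, 3} \<and> count_list p 3 = j \<and> count_list p 2 = k \<and> count_list p 1 = l"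
proof -
  have count: "count_list (part321 j k l) x = (if x = 3 then j else if x = 2 then k else if x = 1 then l else 0)" for x
    by (simp add: part321_def flip: count_mset)
  show ?thesis
  proof
    assume "p = part321 j k l"
    then show "set p \<subseteq> {1, 2, 3} \<and> count_list p 3 = j \<and> count_list p 2 = k \<and> count_list p 1 = l"
      by (auto simp: count) (auto simp: part321_def)
  next
    assume *: "set p \<subseteq> {1, 2, 3} \<and> count_list p 3 = j \<and> count_list p 2 = k \<and> count_list p 1 = l"
    have "count_list p x = count_list (part321 j k l) x" for x
      unfolding count using * by (auto simp: count_list_0_iff)
    then have "mset p = mset (part321 j k l)" by (simp add: multiset_eq_iff count_mset)
    moreover have "sorted_wrt (\<ge>) (replicate n x)" for n and x :: nat
      by (induction n) auto
    then have "sorted_wrt (\<ge>) (part321 j k l)"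
      by (auto simp: part321_def sorted_wrt_append)
    ultimately show "p = part321 j k l"
      using assms by (intro mset_eq_imp_eq) (auto simp: is_partition_def)
  qed
qed

lemma atLeastAtMost_small:
  "{1..1::nat} = {1}" "{1..2::nat} = {1, 2}" "{1..3::nat} = {1, 2, 3}" "{1..4::nat} = {1, 2, 3, 4}"
  by auto

lemma conditions_iff:
  assumes lam: "lam \<in> Diff2_star \<inter> partitions_of N" and "N \<ge> 1"
  shows "((length lam \<ge> 8 \<and> 3 \<notin> set (col_star lam) \<and> 8 \<notin> set (col_star lam)) \<or>
      (5 \<le> length lam \<and> length lam \<le> 7 \<and>
         count_list (col_star lam) 4 \<le> 1 \<and> 3 \<notin> set (col_star lam)) \<or>
      (length lam = 4 \<and>
         (\<exists>j k l. col_star lam = part321 j k l \<and> j \<le> 2 \<and> l mod 7 \<in> {2, 3, 4})) \<or>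
      (length lam = 3 \<and>
         (\<exists>k l. col_star lam = part321 0 k l \<and> l mod 7 \<notin> {3, 4})) \<or>
      (length lam = 2 \<and> count_list (col_star lam) 1 = 1) \<or>
      (length lam = 1 \<and> even (hd lam))) \<longleftrightarrow>
    (\<forall>x\<in>{1..length lam}. allowed (length lam) x (count_list (col_star lam) x))"
proof -
  define m where "m = length lam"
  define p where "p = col_star lam"
  have p: "is_partition p" "set p \<subseteq> {1..m}"
    using col_star_partition[OF lam] by (simp_all add: p_def m_def)
  have "lam \<noteq> []" using lam \<open>N \<ge> 1\<close> by (auto simp: partitions_of_def)
  then have "m \<ge> 1" by (simp add: m_def Suc_le_eq)
  then consider "m \<ge> 8" | "5 \<le> m" "m \<le> 7" | "m = 4" | "m = 3" | "m = 2" | "m = 1" by linarith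
  then show ?thesis
  proof cases
    case 1
    then have "allowed m x i \<longleftrightarrow> (x = 3 \<longrightarrow> i = 0) \<and> (x = 8 \<longrightarrow> i = 0)" for x i
      by (auto simp: allowed_def)
    then have "(\<forall>x\<in>{1..m}. allowed m x (count_list p x)) \<longleftrightarrow> count_list p 3 = 0 \<and> count_list p 8 = 0"
      using 1 by auto
    then show ?thesis using 1 unfolding count_list_0_iff m_def[symmetric] p_def[symmetric] by simp
  next
    case 2
    then have "allowed m x i \<longleftrightarrow> (x = 3 \<longrightarrow> i = 0) \<and> (x = 4 \<longrightarrow> i \<le> 1)" for x i
      by (auto simp: allowed_def)
    then have "(\<forall>x\<in>{1..m}. allowed m x (count_list p x)) \<longleftrightarrow> count_list p 3 = 0 \<and> count_list p 4 \<le> 1"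
      using 2 by auto
    then show ?thesis using 2 unfolding count_list_0_iff m_def[symmetric] p_def[symmetric] by auto
  next
    case 3
    have "set p \<subseteq> {1, 2, 3} \<longleftrightarrow> count_list p 4 = 0"
      using p(2) unfolding count_list_0_iff 3 atLeastAtMost_small by auto
    then have "(\<exists>j k l. p = part321 j k l \<and> j \<le> 2 \<and> l mod 7 \<in> {2, 3, 4}) \<longleftrightarrow>
        count_list p 4 = 0 \<and> count_list p 3 \<le> 2 \<and> count_list p 1 mod 7 \<in> {2, 3, 4}"
      unfolding eq_part321_iff[OF p(1)] by blast
    moreover have "(\<forall>x\<in>{1..m}. allowed m x (count_list p x)) \<longleftrightarrow>
        count_list p 4 = 0 \<and> count_list p 3 \<le> 2 \<and> count_list p 1 mod 7 \<in> {2, 3, 4}"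
      unfolding 3 atLeastAtMost_small allowed_def by auto
    ultimately show ?thesis using 3 unfolding m_def[symmetric] p_def[symmetric] by simp
  next
    case 4
    have "set p \<subseteq> {1, 2, 3}"
      using p(2) unfolding 4 atLeastAtMost_small by auto
    then have "(\<exists>k l. p = part321 0 k l \<and> l mod 7 \<notin> {3, 4}) \<longleftrightarrow>
        count_list p 3 = 0 \<and> count_list p 1 mod 7 \<notin> {3, 4}"
      unfolding eq_part321_iff[OF p(1)] by blast
    moreover have "(\<forall>x\<in>{1..m}. allowed m x (count_list p x)) \<longleftrightarrow>
        count_list p 3 = 0 \<and> count_list p 1 mod 7 \<notin> {3, 4}"
      unfolding 4 atLeastAtMost_small allowed_def by auto
    ultimately show ?thesis using 4 unfolding m_def[symmetric] p_def[symmetric] by simp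
  next
    case 5
    have "(\<forall>x\<in>{1..m}. allowed m x (count_list p x)) \<longleftrightarrow> count_list p 1 = 1"
      unfolding 5 atLeastAtMost_small allowed_def by auto
    then show ?thesis using 5 unfolding m_def[symmetric] p_def[symmetric] by simp
  next
    case 6
    then obtain a where a: "lam = [a]" by (auto simp: m_def length_Suc_conv)
    have "2 \<le> a" using lam a by (simp add: Diff2_star_iff)
    have "p = replicate (a - 2) 1"
    proof -
      have "p = map (\<lambda>j. length (filter (\<lambda>x. j \<le> x) [a - 2])) [1..<Suc (a - 2)]"
        by (simp add: p_def a col_star_def conjugate_def)
      also have "\<dots> = map (\<lambda>j. 1) [1..<Suc (a - 2)]"
        by (intro map_cong refl) auto
      finally show ?thesis by (simp add: map_replicate_const del: upt_Suc)
    qed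
    then have "count_list p 1 = a - 2" by (simp flip: count_mset)
    moreover have "(\<forall>x\<in>{1..m}. allowed m x (count_list p x)) \<longleftrightarrow> even (count_list p 1)"
      unfolding 6 atLeastAtMost_small allowed_def by simp
    ultimately show ?thesis using 6 a \<open>2 \<le> a\<close> unfolding m_def[symmetric] p_def[symmetric] by simp
  qed
qed

lemma card_conditions:
  "of_nat (card {lam \<in> Diff2_star \<inter> partitions_of N. length lam = m \<and>
      (\<forall>x\<in>{1..m}. allowed m x (count_list (col_star lam) x))}) =
    fps_nth (fps_X ^ (m * m + m) * (\<Prod>x\<in>{1..m}. mult_gf x (allowed m x))) N"
proof (cases "m * m + m \<le> N")
  case True
  have "of_nat (card {lam \<in> Diff2_star \<inter> partitions_of N. length lam = m \<and>
      (\<forall>x\<in>{1..m}. allowed m x (count_list (col_star lam) x))}) =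
      fps_nth (\<Prod>x\<in>{1..m}. mult_gf x (allowed m x)) (N - (m * m + m))"
    unfolding card_col_star[OF True, of "\<lambda>p. \<forall>x\<in>{1..m}. allowed m x (count_list p x)"]
    by (rule card_partitions_gf) auto
  then show ?thesis using True by (simp add: fps_X_power_mult_nth)
next
  case False
  then have "{lam \<in> Diff2_star \<inter> partitions_of N. length lam = m \<and>
      (\<forall>x\<in>{1..m}. allowed m x (count_list (col_star lam) x))} = {}"
    using Diff2_star_size by blast
  then show ?thesis using False by (simp only: fps_X_power_mult_nth) simp
qed

section \<open>Comparison of the generating functions\<close>

definition geom :: "nat \<Rightarrow> rat fps" where
  "geom x = mult_gf x (\<lambda>_. True)"

lemma geom_mult: "0 < x \<Longrightarrow> geom x * (1 - fps_X ^ x) = 1"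
  by (simp add: geom_def mult_gf_True)

lemma prod_geom: "(\<Prod>x\<in>{1..m}. geom x) = inverse (qfact fps_X m)"
proof -
  have "qfact fps_X m * (\<Prod>x\<in>{1..m}. geom x) = (\<Prod>x\<in>{1..m}. (1 - fps_X ^ x) * geom x)"
    by (simp add: qfact_def prod.distrib)
  also have "\<dots> = 1"
    by (intro prod.neutral) (simp add: geom_mult mult.commute)
  finally show ?thesis by (simp add: fps_inverse_unique)
qed

lemma mult_gf_0: "0 < x \<Longrightarrow> mult_gf x (\<lambda>i. i = 0) = geom x * (1 - fps_X ^ x)"
  using mult_gf_finite[of x "{0}"] by (simp add: geom_mult)

lemma mult_gf_le_1:
  assumes "0 < x"
  shows "mult_gf x (\<lambda>i. i \<le> 1) = geom x * (1 - fps_X ^ (2 * x))"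
proof -
  have "mult_gf x (\<lambda>i. i \<le> 1) = (\<Sum>i\<in>{..1}. fps_X ^ (x * i))"
    using assms by (intro mult_gf_finite) auto
  also have "\<dots> = 1 + fps_X ^ x" by simp
  also have "\<dots> = (geom x * (1 - fps_X ^ x)) * (1 + fps_X ^ x)"
    using assms by (simp add: geom_mult)
  also have "\<dots> = geom x * (1 - fps_X ^ x * fps_X ^ x)"
    unfolding mult.assoc by (simp only: square_diff_one_factored[symmetric] ring_distribs mult_1_left mult_1_right) simp
  also have "fps_X ^ x * fps_X ^ x = fps_X ^ (2 * x)"
    by (simp only: mult_2 power_add)
  finally show ?thesis .
qed

lemma prod_allowed_large:
  assumes "5 \<le> m"
  shows "(\<Prod>x\<in>{1..m}. mult_gf x (allowed m x)) =
    (1 - fps_X ^ 3) * (1 - fps_X ^ 8) * (\<Prod>x\<in>{1..m}. geom x)"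
proof -
  \<comment> \<open>The part size whose factor absorbs \<open>1 - X^8\<close>. With fewer than eight
    parts, \<open>col_star\<close> has no part 8, but admitting at most one 4 has the same effect
    because \<open>2 * 4 = 8\<close>.\<close>
  define y where "y = (if 8 \<le> m then 8 else 4 :: nat)"
  define c where "c x = (if x = 3 then 1 - fps_X ^ 3 else if x = y then 1 - fps_X ^ 8 else 1 :: rat fps)" for x
  have "(\<Prod>x\<in>{1..m}. mult_gf x (allowed m x)) = (\<Prod>x\<in>{1..m}. geom x * c x)"
  proof (intro prod.cong refl)
    fix x assume "x \<in> {1..m}"
    then have x: "0 < x" by simp
    consider "x = 3" | "x = y" "x \<noteq> 3" | "x \<noteq> 3" "x \<noteq> y" by blast
    then show "mult_gf x (allowed m x) = geom x * c x"
    proof cases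
      case 1
      then have "allowed m x = (\<lambda>i. i = 0)" using assms by (auto simp: allowed_def fun_eq_iff)
      then show ?thesis using 1 x mult_gf_0[of x] by (simp add: c_def)
    next
      case 2
      show ?thesis
      proof (cases "8 \<le> m")
        case True
        then have "allowed m x = (\<lambda>i. i = 0)" using 2 by (auto simp: allowed_def fun_eq_iff y_def)
        then show ?thesis using 2 x mult_gf_0[of x] True by (simp add: c_def y_def)
      next
        case False
        then have "allowed m x = (\<lambda>i. i \<le> 1)" using 2 assms by (auto simp: allowed_def fun_eq_iff y_def)
        then show ?thesis using 2 x mult_gf_le_1[of x] False by (simp add: c_def y_def)
      qed
    next
      case 3
      then have "allowed m x = (\<lambda>i. True)" using assms by (auto simp: allowed_def fun_eq_iff y_def split: if_splits)
      then show ?thesis using 3 by (simp add: c_def geom_def)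
    qed
  qed
  also have "\<dots> = (\<Prod>x\<in>{1..m}. geom x) * (\<Prod>x\<in>{1..m}. c x)"
    by (rule prod.distrib)
  also have "(\<Prod>x\<in>{1..m}. c x) = (\<Prod>x\<in>{3, y}. c x)"
    using assms by (intro prod.mono_neutral_right) (auto simp: c_def y_def)
  also have "\<dots> = (1 - fps_X ^ 3) * (1 - fps_X ^ 8)"
    by (simp add: c_def y_def)
  finally show ?thesis by (simp only: mult_ac)
qed

text \<open>The terms with at most four parts do not agree one by one, only their sums do.\<close>

lemma small_terms_identity:
  fixes x :: "'a::idom"
  assumes f1: "f1 * (1 - x) = 1" and f2: "f2 * (1 - x ^ 2) = 1" and f3: "f3 * (1 - x ^ 3) = 1"
    and f4: "f4 * (1 - x ^ 4) = 1"
    and g3: "g3 * (1 - x ^ 7) = 1 + x + x ^ 2 + x ^ 5 + x ^ 6"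
    and g4: "g4 * (1 - x ^ 7) = x ^ 2 + x ^ 3 + x ^ 4"
    and nz: "1 - x ^ 7 \<noteq> 0"
  shows "1 + x ^ 2 * f2 + x ^ 6 * (x * f2) + x ^ 12 * (g3 * f2) + x ^ 20 * (g4 * f2 * (1 + x ^ 3 + x ^ 6)) =
    (1 - x ^ 3) * (1 - x ^ 8) *
      (1 + x ^ 2 * f1 + x ^ 6 * (f1 * f2) + x ^ 12 * (f1 * f2 * f3) + x ^ 20 * (f1 * f2 * f3 * f4))"
    (is "?l = ?r")
proof -
  \<comment> \<open>Origin of the constants: the right side minus the first three terms of the left
    is \<open>(x^12 - x^15 + x^17 + x^24) / ((1-x)(1-x^2))\<close>. The term with \<open>g3\<close>
    is \<open>x^12 / ((1-x)(1-x^2)) - x^15 / ((1-x)(1-x^7))\<close>, where the subtracted piece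
    comes from the excluded residues 3 and 4. What remains is
    \<open>x^22 (1-x^9) / ((1-x)(1-x^2)(1-x^7))\<close>, and
    \<open>(1-x^9)/(1-x) = (1+x+x^2)(1+x^3+x^6)\<close> yields the residues 2, 3, 4 and the bound of
    two on the number of 3s. \<open>D\<close> is the common denominator.\<close>
  define D where "D = (1 - x) * (1 - x ^ 2) * (1 - x ^ 7)"
  have "?l * D = (1 - x) * ((1 - x ^ 2) * (1 - x ^ 7) + x ^ 2 * (f2 * (1 - x ^ 2)) * (1 - x ^ 7)
      + x ^ 7 * (f2 * (1 - x ^ 2)) * (1 - x ^ 7) + x ^ 12 * (g3 * (1 - x ^ 7)) * (f2 * (1 - x ^ 2))
      + x ^ 20 * (g4 * (1 - x ^ 7)) * (f2 * (1 - x ^ 2)) * (1 + x ^ 3 + x ^ 6))"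
    unfolding D_def by algebra
  \<comment> \<open>Each \<open>f\<close> is grouped with its own denominator so that the hypotheses
    become rewrite rules. The denominators of \<open>f3\<close> and \<open>f4\<close> are taken from
    \<open>(1 - x ^ 3) * (1 - x ^ 8)\<close>, not from \<open>D\<close>.\<close>
  moreover have "?r * D = (1 - x ^ 7) * ((1 - x ^ 3) * (1 - x ^ 8) * ((1 - x) * (1 - x ^ 2)
      + x ^ 2 * (f1 * (1 - x)) * (1 - x ^ 2) + x ^ 6 * (f1 * (1 - x)) * (f2 * (1 - x ^ 2)))
      + x ^ 12 * (1 - x ^ 8) * (f1 * (1 - x)) * (f2 * (1 - x ^ 2)) * (f3 * (1 - x ^ 3))
      + x ^ 20 * (1 + x ^ 4) * (f1 * (1 - x)) * (f2 * (1 - x ^ 2)) * (f3 * (1 - x ^ 3)) * (f4 * (1 - x ^ 4)))"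
    unfolding D_def by algebra
  ultimately have "?l * D = ?r * D"
    unfolding f1 f2 f3 f4 g3 g4 by algebra
  moreover have "D \<noteq> 0" using f1 f2 nz by (auto simp: D_def)
  ultimately show ?thesis by simp
qed

lemma one_minus_fps_X_power_neq_0: "0 < x \<Longrightarrow> 1 - fps_X ^ x \<noteq> (0 :: rat fps)"
  using geom_mult[of x] by (metis mult_zero_right zero_neq_one)

text \<open>The summand 1 is the contribution of \<open>m = 0\<close>; without it the series differ
  in the constant term. From \<open>m = 5\<close> on the terms agree individually.\<close>

lemma sum_conditions:
  assumes "4 \<le> M"
  shows "1 + (\<Sum>m\<in>{1..M}. fps_X ^ (m * m + m) * (\<Prod>x\<in>{1..m}. mult_gf x (allowed m x))) =
    (1 - fps_X ^ 3) * (1 - fps_X ^ 8) * (\<Sum>m\<le>M. fps_X ^ (m * m + m) * inverse (qfact fps_X m))"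
proof -
  let ?X = "fps_X :: rat fps"
  define a where "a m = ?X ^ (m * m + m) * (\<Prod>x\<in>{1..m}. mult_gf x (allowed m x))" for m
  define b where "b m = ?X ^ (m * m + m) * (\<Prod>x\<in>{1..m}. geom x)" for m
  define c where "c = (1 - ?X ^ 3) * (1 - ?X ^ 8)"
  define g3 g4 where "g3 = mult_gf 1 (allowed 3 1)" and "g4 = mult_gf 1 (allowed 4 1)"
  have less_7: "i < 7 \<longleftrightarrow> i = 0 \<or> i = 1 \<or> i = 2 \<or> i = 3 \<or> i = 4 \<or> i = 5 \<or> i = 6" for i :: nat
    by presburger
  have g3: "g3 * (1 - ?X ^ 7) = 1 + ?X + ?X ^ 2 + ?X ^ 5 + ?X ^ 6"
  proof -
    have "{i. i < 7 \<and> allowed 3 1 i} = {0, 1, 2, 5, 6}"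
      unfolding less_7 by (auto simp: allowed_def)
    moreover have "g3 * (1 - ?X ^ 7) = (\<Sum>i | i < 7 \<and> allowed 3 1 i. ?X ^ i)"
      using mult_gf_periodic[of 1 7 "allowed 3 1"] by (simp add: g3_def allowed_def)
    moreover have "(\<Sum>i\<in>{0, 1, 2, 5, 6}. x ^ i) = 1 + x + x ^ 2 + x ^ 5 + x ^ 6" for x :: "rat fps"
      by (simp add: add.assoc)
    ultimately show ?thesis by (simp only:)
  qed
  have g4: "g4 * (1 - ?X ^ 7) = ?X ^ 2 + ?X ^ 3 + ?X ^ 4"
  proof -
    have "{i. i < 7 \<and> allowed 4 1 i} = {2, 3, 4}"
      unfolding less_7 by (auto simp: allowed_def)
    moreover have "g4 * (1 - ?X ^ 7) = (\<Sum>i | i < 7 \<and> allowed 4 1 i. ?X ^ i)"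
      using mult_gf_periodic[of 1 7 "allowed 4 1"] by (simp add: g4_def allowed_def)
    moreover have "(\<Sum>i\<in>{2, 3, 4}. x ^ i) = x ^ 2 + x ^ 3 + x ^ 4" for x :: "rat fps"
      by (simp add: add.assoc)
    ultimately show ?thesis by (simp only:)
  qed
  have A1: "mult_gf 1 (allowed 1 1) = geom 2"
  proof -
    have "{i. i < 2 \<and> allowed 1 1 i} = {0}"
      by (auto simp: allowed_def less_2_cases_iff)
    then have "mult_gf 1 (allowed 1 1) * (1 - ?X ^ 2) = 1"
      using mult_gf_periodic[of 1 2 "allowed 1 1"] by (simp add: allowed_def)
    then have "mult_gf 1 (allowed 1 1) * (1 - ?X ^ 2) = geom 2 * (1 - ?X ^ 2)"
      using geom_mult[of 2] by simp
    then show ?thesis using one_minus_fps_X_power_neq_0[of 2] by (simp only: mult_cancel_right) simp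
  qed
  have A2: "mult_gf 1 (allowed 2 1) = ?X"
    using mult_gf_finite[of 1 "{1}" "allowed 2 1"] by (simp add: allowed_def)
  have free: "mult_gf 2 (allowed m 2) = geom 2" if "m \<in> {2, 3, 4}" for m
    using that by (auto simp: allowed_def[abs_def] geom_def)
  have zero: "mult_gf 3 (allowed 3 3) = 1" "mult_gf 4 (allowed 4 4) = 1"
    using mult_gf_finite[of _ "{0}"] by (simp_all add: allowed_def)
  have A4: "mult_gf 3 (allowed 4 3) = 1 + ?X ^ 3 + ?X ^ 6"
  proof -
    have "mult_gf 3 (allowed 4 3) = (\<Sum>i\<in>{0, 1, 2}. ?X ^ (3 * i))"
      by (intro mult_gf_finite) (auto simp: allowed_def)
    then show ?thesis by simp
  qed
  have nz: "1 - ?X ^ 7 \<noteq> 0" by (rule one_minus_fps_X_power_neq_0) simp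
  have e: "1 * 1 + 1 = (2 :: nat)" "2 * 2 + 2 = (6 :: nat)" "3 * 3 + 3 = (12 :: nat)" "4 * 4 + 4 = (20 :: nat)"
    by simp_all
  have small: "1 + (\<Sum>m\<in>{1..4}. a m) = c * (\<Sum>m\<le>4. b m)"
  proof -
    have a: "a 1 = ?X ^ 2 * geom 2" "a 2 = ?X ^ 6 * (?X * geom 2)" "a 3 = ?X ^ 12 * (g3 * geom 2)"
      "a 4 = ?X ^ 20 * (g4 * geom 2 * (1 + ?X ^ 3 + ?X ^ 6))"
      unfolding a_def atLeastAtMost_small e
      using A1 A2 free zero A4 by (simp_all add: g3_def g4_def mult.assoc)
    have b: "b 0 = 1" "b 1 = ?X ^ 2 * geom 1" "b 2 = ?X ^ 6 * (geom 1 * geom 2)"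
      "b 3 = ?X ^ 12 * (geom 1 * geom 2 * geom 3)"
      "b 4 = ?X ^ 20 * (geom 1 * geom 2 * geom 3 * geom 4)"
      unfolding b_def atLeastAtMost_small e by (simp_all add: mult.assoc)
    have "1 + (\<Sum>m\<in>{1..4}. a m) = 1 + a 1 + a 2 + a 3 + a 4"
      unfolding atLeastAtMost_small by (simp add: add.assoc)
    also have "\<dots> = c * (b 0 + b 1 + b 2 + b 3 + b 4)"
      unfolding a b c_def
      by (rule small_terms_identity[OF _ geom_mult geom_mult geom_mult g3 g4 nz])
         (use geom_mult[of 1] in simp_all)
    also have "b 0 + b 1 + b 2 + b 3 + b 4 = (\<Sum>m\<le>4. b m)"
    proof -
      have "{..4::nat} = {0, 1, 2, 3, 4}" by auto
      then show ?thesis by (simp add: add.assoc)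
    qed
    finally show ?thesis .
  qed
  have large: "a m = c * b m" if "m \<in> {5..M}" for m
  proof -
    have "5 \<le> m" using that by simp
    then show ?thesis
      by (simp only: a_def b_def c_def prod_allowed_large) (rule mult.left_commute)
  qed
  have "{1..M} = {1..4} \<union> {5..M}" using assms by auto
  then have "(\<Sum>m\<in>{1..M}. a m) = (\<Sum>m\<in>{1..4}. a m) + (\<Sum>m\<in>{5..M}. a m)"
    by (simp only:) (rule sum.union_disjoint; auto)
  then have "1 + (\<Sum>m\<in>{1..M}. a m) = c * (\<Sum>m\<le>4. b m) + (\<Sum>m\<in>{5..M}. a m)"
    by (simp only: add.assoc[symmetric] small)
  also have "(\<Sum>m\<in>{5..M}. a m) = c * (\<Sum>m\<in>{5..M}. b m)"
    unfolding sum_distrib_left by (intro sum.cong refl large)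
  also have "c * (\<Sum>m\<le>4. b m) + c * (\<Sum>m\<in>{5..M}. b m) = c * (\<Sum>m\<le>M. b m)"
  proof -
    have "{..M} = {..4} \<union> {5..M}" using assms by auto
    then have "(\<Sum>m\<le>M. b m) = (\<Sum>m\<le>4. b m) + (\<Sum>m\<in>{5..M}. b m)"
      by (simp only:) (rule sum.union_disjoint; auto)
    then show ?thesis by (simp only: distrib_left)
  qed
  finally show ?thesis by (simp only: a_def b_def c_def prod_geom)
qed

lemma card_mod_5:
  assumes "N \<ge> 1"
  shows "of_nat (card {p \<in> partitions_of N.
      (\<forall>x \<in> set p. x mod 5 = 2 \<or> x mod 5 = 3) \<and> 3 \<notin> set p \<and> 8 \<notin> set p}) =
    fps_nth ((1 - fps_X ^ 3) * (1 - fps_X ^ 8) *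
      (\<Sum>m\<le>N + 8. fps_X ^ (m * m + m) * inverse (qfact (fps_X :: rat fps) m))) N"
proof -
  let ?X = "fps_X :: rat fps"
  \<comment> \<open>The second Rogers-Ramanujan identity is applied with \<open>K = N + 1\<close>,
    which asks for \<open>3 * K \<le> n\<close>. Elements of \<open>S\<close> above \<open>N\<close>
    cannot occur in a partition of \<open>N\<close>.\<close>
  define n where "n = 3 * (N + 1)"
  define S2 where "S2 = (\<lambda>i. 5 * i + 2 :: nat) ` {..<n}"
  define S3 where "S3 = (\<lambda>i. 5 * i + 3 :: nat) ` {..<n}"
  define S where "S = S2 \<union> S3"
  define A :: "nat \<Rightarrow> nat \<Rightarrow> bool" where "A x i \<longleftrightarrow> (x \<in> {3, 8} \<longrightarrow> i = 0)" for x i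
  define H where "H = (\<Sum>m\<le>N + 8. ?X ^ (m * m + m) * inverse (qfact ?X m))"
  have S: "finite S" "0 \<notin> S" by (auto simp: S_def S2_def S3_def)
  have disj: "S2 \<inter> S3 = {}"
  proof -
    have "5 * i + 2 \<noteq> 5 * j + 3" for i j :: nat by presburger
    then show ?thesis by (auto simp: S2_def S3_def)
  qed
  have in_S: "x \<in> S" if "x mod 5 = 2 \<or> x mod 5 = 3" "x \<le> N" for x
  proof -
    have "x div 5 < n" using that(2) by (simp add: n_def)
    moreover have "x = 5 * (x div 5) + x mod 5" by simp
    ultimately show ?thesis using that(1) unfolding S_def S2_def S3_def by (metis UnI1 UnI2 image_eqI lessThan_iff)
  qed
  have S_mod: "x mod 5 = 2 \<or> x mod 5 = 3" if "x \<in> S" for x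
  proof -
    have "(5 * i + 2) mod 5 = 2" "(5 * i + 3) mod 5 = 3" for i :: nat by presburger+
    with that show ?thesis unfolding S_def S2_def S3_def by blast
  qed
  have "3 \<in> S" using image_eqI[of 3 "\<lambda>i. 5 * i + 3" 0 "{..<n}"] by (simp add: S_def S3_def n_def)
  have "8 \<in> S" using image_eqI[of 8 "\<lambda>i. 5 * i + 3" 1 "{..<n}"] by (simp add: S_def S3_def n_def)
  have "{p \<in> partitions_of N. (\<forall>x \<in> set p. x mod 5 = 2 \<or> x mod 5 = 3) \<and> 3 \<notin> set p \<and> 8 \<notin> set p} =
      {p \<in> partitions_of N. set p \<subseteq> S \<and> (\<forall>x\<in>S. A x (count_list p x))}"
  proof (rule Collect_cong, rule conj_cong[OF refl])
    fix p assume "p \<in> partitions_of N"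
    then have "x \<le> N" if "x \<in> set p" for x
      using member_le_sum_list[OF that] by (simp add: partitions_of_def)
    then have "(\<forall>x\<in>set p. x mod 5 = 2 \<or> x mod 5 = 3) \<longleftrightarrow> set p \<subseteq> S"
      using in_S S_mod by blast
    moreover have "3 \<notin> set p \<and> 8 \<notin> set p \<longleftrightarrow> (\<forall>x\<in>S. A x (count_list p x))"
      using \<open>3 \<in> S\<close> \<open>8 \<in> S\<close> by (auto simp: A_def count_list_0_iff)
    ultimately show "((\<forall>x\<in>set p. x mod 5 = 2 \<or> x mod 5 = 3) \<and> 3 \<notin> set p \<and> 8 \<notin> set p) \<longleftrightarrow>
        (set p \<subseteq> S \<and> (\<forall>x\<in>S. A x (count_list p x)))" by blast
  qed
  then have card: "of_nat (card {p \<in> partitions_of N.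
      (\<forall>x \<in> set p. x mod 5 = 2 \<or> x mod 5 = 3) \<and> 3 \<notin> set p \<and> 8 \<notin> set p}) =
      fps_nth (\<Prod>x\<in>S. mult_gf x (A x)) N"
    using card_partitions_gf[OF S] by simp
  define c where "c x = (if x \<in> {3, 8} then 1 - ?X ^ x else 1)" for x
  have "(\<Prod>x\<in>S. mult_gf x (A x)) = (\<Prod>x\<in>S. geom x * c x)"
  proof (intro prod.cong refl)
    fix x assume "x \<in> S"
    then have x: "0 < x" using S(2) by (cases x) auto
    show "mult_gf x (A x) = geom x * c x"
      using mult_gf_0[OF x] by (cases "x \<in> {3, 8}") (auto simp: A_def[abs_def] c_def geom_def)
  qed
  also have "\<dots> = (\<Prod>x\<in>S. geom x) * (\<Prod>x\<in>S. c x)" by (rule prod.distrib)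
  also have "(\<Prod>x\<in>S. c x) = (\<Prod>x\<in>{3, 8}. c x)"
    using S(1) \<open>3 \<in> S\<close> \<open>8 \<in> S\<close> by (intro prod.mono_neutral_right) (auto simp: c_def)
  also have "\<dots> = (1 - ?X ^ 3) * (1 - ?X ^ 8)" by (simp add: c_def)
  finally have gf: "(\<Prod>x\<in>S. mult_gf x (A x)) = (\<Prod>x\<in>S. geom x) * ((1 - ?X ^ 3) * (1 - ?X ^ 8))" .
  define R where "R = (\<Prod>i<n. (1 - ?X ^ (5 * i + 2)) * (1 - ?X ^ (5 * i + 3)))"
  have "(\<Prod>x\<in>S. 1 - ?X ^ x) = (\<Prod>x\<in>S2. 1 - ?X ^ x) * (\<Prod>x\<in>S3. 1 - ?X ^ x)"
    unfolding S_def using disj by (intro prod.union_disjoint) (auto simp: S2_def S3_def)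
  also have "\<dots> = R"
    unfolding S2_def S3_def R_def by (simp add: prod.reindex inj_on_def prod.distrib)
  finally have R: "(\<Prod>x\<in>S. 1 - ?X ^ x) = R" .
  have GR: "(\<Prod>x\<in>S. geom x) * R = 1"
    unfolding R[symmetric] prod.distrib[symmetric]
    by (intro prod.neutral ballI geom_mult) (use S(2) in \<open>metis gr0I\<close>)
  \<comment> \<open>The product of the \<open>geom x\<close> is the exact inverse of the finite
    product \<open>R\<close>, so the congruence of \<open>R * H\<close> with 1 identifies it with
    \<open>H\<close> up to the coefficient of \<open>X^N\<close>.\<close>
  have "agree (N + 1) ((\<Prod>x\<in>S. geom x) * (R * H)) ((\<Prod>x\<in>S. geom x) * 1)"
    unfolding R_def H_def
    by (intro agree_mult agree_refl rogers_ramanujan_2) (simp_all add: n_def)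
  then have "agree (N + 1) H (\<Prod>x\<in>S. geom x)"
    by (simp add: mult.assoc[symmetric] GR)
  from agree_mult[OF agree_refl this, of "(1 - ?X ^ 3) * (1 - ?X ^ 8)"]
  show ?thesis unfolding card gf H_def[symmetric]
    by (simp add: agree_def mult.commute)
qed

theorem theorem8:
  fixes N :: nat
  assumes "N \<ge> 1"
  shows "card {p \<in> partitions_of N.
                 (\<forall>x \<in> set p. x mod 5 = 2 \<or> x mod 5 = 3) \<and> 3 \<notin> set p \<and> 8 \<notin> set p} =
         card {lam \<in> Diff2_star \<inter> partitions_of N.
                 (length lam \<ge> 8 \<and> 3 \<notin> set (col_star lam) \<and> 8 \<notin> set (col_star lam)) \<or>
                 (5 \<le> length lam \<and> length lam \<le> 7 \<and>
                    count_list (col_star lam) 4 \<le> 1 \<and> 3 \<notin> set (col_star lam)) \<or>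
                 (length lam = 4 \<and>
                    (\<exists>j k l. col_star lam = part321 j k l \<and> j \<le> 2 \<and> l mod 7 \<in> {2, 3, 4})) \<or>
                 (length lam = 3 \<and>
                    (\<exists>k l. col_star lam = part321 0 k l \<and> l mod 7 \<notin> {3, 4})) \<or>
                 (length lam = 2 \<and> count_list (col_star lam) 1 = 1) \<or>
                 (length lam = 1 \<and> even (hd lam))}"
    (is "?l = card ?R")
proof -
  let ?X = "fps_X :: rat fps"
  \<comment> \<open>The bound has to be at least \<open>N + 1\<close> for the congruence and at
    least 4 for the terms that are compared jointly.\<close>
  let ?M = "N + 8"
  define B where "B m = {lam \<in> Diff2_star \<inter> partitions_of N. length lam = m \<and>
      (\<forall>x\<in>{1..m}. allowed m x (count_list (col_star lam) x))}" for m
  have fin: "finite (B m)" for m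
    using finite_partitions_of[of N] by (rule rev_finite_subset) (unfold B_def, blast)
  have disj: "B i \<inter> B j = {}" if "i \<noteq> j" for i j
    using that unfolding B_def by blast
  have "?R = {lam \<in> Diff2_star \<inter> partitions_of N.
      \<forall>x\<in>{1..length lam}. allowed (length lam) x (count_list (col_star lam) x)}"
    by (rule Collect_cong, rule conj_cong[OF refl], rule conditions_iff[OF _ assms])
  also have "\<dots> = (\<Union>m\<in>{1..?M}. B m)"
  proof -
    have "length lam \<in> {1..?M}" if "lam \<in> Diff2_star \<inter> partitions_of N" for lam
    proof -
      have "lam \<noteq> []" using that assms by (auto simp: partitions_of_def)
      then show ?thesis using Diff2_star_size[OF that] by (simp add: Suc_le_eq)
    qed
    then show ?thesis unfolding B_def by blast
  qed
  finally have "?R = (\<Union>m\<in>{1..?M}. B m)" .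
  moreover have "card (\<Union>m\<in>{1..?M}. B m) = (\<Sum>m\<in>{1..?M}. card (B m))"
    using fin disj by (intro card_UN_disjoint) blast+
  ultimately have "card ?R = (\<Sum>m\<in>{1..?M}. card (B m))"
    by (rule trans[OF arg_cong[of _ _ card]])
  then have "of_nat (card ?R) = fps_nth (\<Sum>m\<in>{1..?M}. ?X ^ (m * m + m) * (\<Prod>x\<in>{1..m}. mult_gf x (allowed m x))) N"
    by (simp only: of_nat_sum B_def card_conditions fps_sum_nth)
  \<comment> \<open>The term for \<open>m = 0\<close> is inserted; it does not affect the
    coefficient of \<open>X^N\<close> because \<open>N \<ge> 1\<close>.\<close>
  also have "\<dots> = fps_nth (1 + (\<Sum>m\<in>{1..?M}. ?X ^ (m * m + m) * (\<Prod>x\<in>{1..m}. mult_gf x (allowed m x)))) N"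
    using assms by (simp only: fps_add_nth) simp
  also have "\<dots> = of_nat ?l"
  proof -
    have "4 \<le> ?M" by simp
    then show ?thesis unfolding card_mod_5[OF assms] by (simp only: sum_conditions)
  qed
  finally have "of_nat (card ?R) = (of_nat ?l :: rat)" .
  then show ?thesis by (simp only: of_nat_eq_iff)
qed

end
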